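(* Let $(H,\mu_H,\Delta_H,\alpha_H,R)$ be a quasitriangular Hom-bialgebra such that $(\alpha_H\otimes\alpha_H)(R)=R$. (i) Let $(M,\alpha_M)$ be a left $H$-module with action $h\otimes m\mapsto h\cdot m$. Define the linear map $\lambda_M:M\to H\otimes M$, $\lambda_M(m)=m_{(-1)}\otimes m_{(0)}:=\alpha_H(R^2)\otimes R^1\cdot m$. Then $(M,\alpha_M)$ with these structures is a Yetter-Drinfeld module over $H$. (ii) Assume that $\alpha_H$ is bijective. Let $(M,\alpha_M)$ be as in (i) and let $(N,\alpha_N)$ be another left $H$-module with action $h\otimes n\mapsto h\cdot n$, regarded as a Yetter-Drinfeld module as in (i), via the map $\lambda_N:N\to H\otimes N$, $\lambda_N(n)=n_{(-1)}\otimes n_{(0)}:=\alpha_H(r^2)\otimes r^1\cdot n$. Regard $(M\otimes N,\alpha_M\otimes\alpha_N)$ as a left $H$-module via $h\cdot(m\otimes n)=h_1\cdot m\otimes h_2\cdot n$, and then as a Yetter-Drinfeld module as in (i). Then this Yetter-Drinfeld module coincides with the Yetter-Drinfeld module $M\hat\otimes N$, that is, $(M\otimes N,\alpha_M\otimes\alpha_N)$ with action $h\cdot(m\otimes n)=h_1\cdot m\otimes h_2\cdot n$ and coaction $m\otimes n\mapsto\alpha_H^{-2}(m_{(-1)}n_{(-1)})\otimes(m_{(0)}\otimes n_{(0)})$.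
   Context: Everything is over a field $k$, $\otimes=\otimes_k$; (co)algebras are not assumed (co)unital. Sweedler notation: $\Delta(h)=h_1\otimes h_2$; multiplications are written by juxtaposition. A Hom-bialgebra is $(H,\mu,\Delta,\alpha)$ with $\mu:H\otimes H\to H$, $\Delta:H\to H\otimes H$, $\alpha:H\to H$ linear such that for all $h,h',h''$: $\alpha(hh')=\alpha(h)\alpha(h')$; $\alpha(h)(h'h'')=(hh')\alpha(h'')$; $\Delta(h_1)\otimes\alpha(h_2)=\alpha(h_1)\otimes\Delta(h_2)$; $\Delta(hh')=h_1h'_1\otimes h_2h'_2$; $\Delta(\alpha(h))=\alpha(h_1)\otimes\alpha(h_2)$. It is quasitriangular, with $R=R^1\otimes R^2=r^1\otimes r^2\in H\otimes H$ (summation understood), if $(\Delta\otimes\alpha)(R)=\alpha(R^1)\otimes\alpha(r^1)\otimes R^2r^2$, $(\alpha\otimes\Delta)(R)=R^1r^1\otimes\alpha(r^2)\otimes\alpha(R^2)$, and $\Delta^{cop}(h)R=R\Delta(h)$ for all $h\in H$, where $\Delta^{cop}(h)=h_2\otimes h_1$ and $H\otimes H$ has the componentwise multiplication. Let $(H,\mu_H,\Delta_H,\alpha_H)$ be a Hom-bialgebra, $M$ a linear space, $\alpha_M:M\to M$ linear. $(M,\alpha_M)$ is a left $H$-module if there is a linear map $H\otimes M\to M$, $h\otimes m\mapsto h\cdot m$, with $\alpha_M(h\cdot m)=\alpha_H(h)\cdot\alpha_M(m)$ and $\alpha_H(h)\cdot(h'\cdot m)=(hh')\cdot\alpha_M(m)$.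 It is a left $H$-comodule if there is a linear map $\lambda:M\to H\otimes M$, $\lambda(m)=m_{(-1)}\otimes m_{(0)}$, with $(\alpha_H\otimes\alpha_M)\circ\lambda=\lambda\circ\alpha_M$ and $(\Delta_H\otimes\alpha_M)\circ\lambda=(\alpha_H\otimes\lambda)\circ\lambda$. $(M,\alpha_M)$ is a (left-left) Yetter-Drinfeld module over $H$ if it is both a left $H$-module and a left $H$-comodule and, for all $h\in H$, $m\in M$, $$(h_1\cdot m)_{(-1)}\alpha_H^2(h_2)\otimes(h_1\cdot m)_{(0)}=\alpha_H^2(h_1)\alpha_H(m_{(-1)})\otimes\alpha_H(h_2)\cdot m_{(0)}.$$ *)

theory Defs
  imports "HOL-Algebra.Module" "HOL-Algebra.AbelCoset"
begin

section \<open>Tensor products of vector spaces\<close>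

text \<open>
  A vector space over the field \<open>K\<close> is a \<^locale>\<open>module\<close> over \<open>K\<close>.  The ring fields
  \<open>mult\<close> and \<open>one\<close> of the record \<^type>\<open>module\<close> play no role for a module, and are left
  unspecified in the constructions below.
\<close>

definition linear_maps ::
  "('k, 'p) ring_scheme \<Rightarrow> ('k, 'a, 'q) module_scheme \<Rightarrow> ('k, 'b, 'r) module_scheme \<Rightarrow> ('a \<Rightarrow> 'b) set"
  where "linear_maps K V W = {f \<in> carrier V \<rightarrow> carrier W.
    (\<forall>x\<in>carrier V. \<forall>y\<in>carrier V. f (x \<oplus>\<^bsub>V\<^esub> y) = f x \<oplus>\<^bsub>W\<^esub> f y) \<and>
    (\<forall>c\<in>carrier K. \<forall>x\<in>carrier V. f (c \<odot>\<^bsub>V\<^esub> x) = c \<odot>\<^bsub>W\<^esub> f x)}"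

definition bilinear_maps ::
  "('k, 'p) ring_scheme \<Rightarrow> ('k, 'a, 'q) module_scheme \<Rightarrow> ('k, 'b, 'r) module_scheme \<Rightarrow>
   ('k, 'c, 's) module_scheme \<Rightarrow> ('a \<Rightarrow> 'b \<Rightarrow> 'c) set"
  where "bilinear_maps K U V W = {\<beta>.
    (\<forall>u\<in>carrier U. \<beta> u \<in> linear_maps K V W) \<and>
    (\<forall>v\<in>carrier V. (\<lambda>u. \<beta> u v) \<in> linear_maps K U W)}"

text \<open>The vector space with basis \<open>S\<close>, as finitely supported functions \<open>S \<rightarrow> K\<close>.\<close>

definition free_space :: "('k, 'p) ring_scheme \<Rightarrow> 'i set \<Rightarrow> ('k, 'i \<Rightarrow> 'k) module"
  where "free_space K S = \<lparr>
    carrier = {f. (\<forall>i. f i \<in> carrier K) \<and> (\<forall>i. i \<notin> S \<longrightarrow> f i = \<zero>\<^bsub>K\<^esub>) \<and> finite {i. f i \<noteq> \<zero>\<^bsub>K\<^esub>}},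
    monoid.mult = undefined, one = undefined,
    zero = (\<lambda>i. \<zero>\<^bsub>K\<^esub>),
    add = (\<lambda>f g i. f i \<oplus>\<^bsub>K\<^esub> g i),
    smult = (\<lambda>c f i. c \<otimes>\<^bsub>K\<^esub> f i)\<rparr>"

definition free_basis :: "('k, 'p) ring_scheme \<Rightarrow> 'i \<Rightarrow> 'i \<Rightarrow> 'k"
  where "free_basis K i = (\<lambda>j. if j = i then \<one>\<^bsub>K\<^esub> else \<zero>\<^bsub>K\<^esub>)"

definition quotient_space ::
  "('k, 'p) ring_scheme \<Rightarrow> ('k, 'a, 'q) module_scheme \<Rightarrow> 'a set \<Rightarrow> ('k, 'a set) module"
  where "quotient_space K V U = \<lparr>
    carrier = a_rcosets\<^bsub>V\<^esub> U,
    monoid.mult = undefined, one = undefined,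
    zero = U,
    add = set_add V,
    smult = (\<lambda>c X. \<Union>x\<in>X. U +>\<^bsub>V\<^esub> (c \<odot>\<^bsub>V\<^esub> x))\<rparr>"

definition tensor_relators ::
  "('k, 'p) ring_scheme \<Rightarrow> ('k, 'a, 'q) module_scheme \<Rightarrow> ('k, 'b, 'r) module_scheme \<Rightarrow>
   ('a \<times> 'b \<Rightarrow> 'k) set"
  where "tensor_relators K A B =
    (let F = free_space K (carrier A \<times> carrier B); e = (\<lambda>a b. free_basis K (a, b)) in
      {e (a \<oplus>\<^bsub>A\<^esub> a') b \<ominus>\<^bsub>F\<^esub> (e a b \<oplus>\<^bsub>F\<^esub> e a' b) |a a' b.
          a \<in> carrier A \<and> a' \<in> carrier A \<and> b \<in> carrier B} \<union>
      {e a (b \<oplus>\<^bsub>B\<^esub> b') \<ominus>\<^bsub>F\<^esub> (e a b \<oplus>\<^bsub>F\<^esub> e a b') |a b b'.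
          a \<in> carrier A \<and> b \<in> carrier B \<and> b' \<in> carrier B} \<union>
      {e (c \<odot>\<^bsub>A\<^esub> a) b \<ominus>\<^bsub>F\<^esub> c \<odot>\<^bsub>F\<^esub> e a b |c a b.
          c \<in> carrier K \<and> a \<in> carrier A \<and> b \<in> carrier B} \<union>
      {e a (c \<odot>\<^bsub>B\<^esub> b) \<ominus>\<^bsub>F\<^esub> c \<odot>\<^bsub>F\<^esub> e a b |c a b.
          c \<in> carrier K \<and> a \<in> carrier A \<and> b \<in> carrier B})"

definition tensor_kernel ::
  "('k, 'p) ring_scheme \<Rightarrow> ('k, 'a, 'q) module_scheme \<Rightarrow> ('k, 'b, 'r) module_scheme \<Rightarrow>
   ('a \<times> 'b \<Rightarrow> 'k) set"
  where "tensor_kernel K A B =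
    \<Inter>{U. submodule U K (free_space K (carrier A \<times> carrier B)) \<and> tensor_relators K A B \<subseteq> U}"

definition tensor_space ::
  "('k, 'a, 'q) module_scheme \<Rightarrow> ('k, 'p) ring_scheme \<Rightarrow> ('k, 'b, 'r) module_scheme \<Rightarrow>
   ('k, ('a \<times> 'b \<Rightarrow> 'k) set) module"
  (\<open>(_ \<boxtimes>\<^bsub>_\<^esub> _)\<close> [71, 0, 70] 70)
  where "A \<boxtimes>\<^bsub>K\<^esub> B =
    quotient_space K (free_space K (carrier A \<times> carrier B)) (tensor_kernel K A B)"

definition pure_tensor ::
  "('k, 'p) ring_scheme \<Rightarrow> ('k, 'a, 'q) module_scheme \<Rightarrow> ('k, 'b, 'r) module_scheme \<Rightarrow>
   'a \<Rightarrow> 'b \<Rightarrow> ('a \<times> 'b \<Rightarrow> 'k) set"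
  where "pure_tensor K A B a b =
    tensor_kernel K A B +>\<^bsub>free_space K (carrier A \<times> carrier B)\<^esub> free_basis K (a, b)"

subsection \<open>The universal property\<close>

lemma linear_mapsI:
  assumes "\<And>x. x \<in> carrier V \<Longrightarrow> f x \<in> carrier W"
    and "\<And>x y. \<lbrakk>x \<in> carrier V; y \<in> carrier V\<rbrakk> \<Longrightarrow> f (x \<oplus>\<^bsub>V\<^esub> y) = f x \<oplus>\<^bsub>W\<^esub> f y"
    and "\<And>c x. \<lbrakk>c \<in> carrier K; x \<in> carrier V\<rbrakk> \<Longrightarrow> f (c \<odot>\<^bsub>V\<^esub> x) = c \<odot>\<^bsub>W\<^esub> f x"
  shows "f \<in> linear_maps K V W"
  using assms by (auto simp: linear_maps_def)

lemma linear_mapsD: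
  assumes "f \<in> linear_maps K V W"
  shows "x \<in> carrier V \<Longrightarrow> f x \<in> carrier W"
    and "\<lbrakk>x \<in> carrier V; y \<in> carrier V\<rbrakk> \<Longrightarrow> f (x \<oplus>\<^bsub>V\<^esub> y) = f x \<oplus>\<^bsub>W\<^esub> f y"
    and "\<lbrakk>c \<in> carrier K; x \<in> carrier V\<rbrakk> \<Longrightarrow> f (c \<odot>\<^bsub>V\<^esub> x) = c \<odot>\<^bsub>W\<^esub> f x"
  using assms by (auto simp: linear_maps_def)

lemma linear_maps_zero:
  assumes "module K V" "module K W" "f \<in> linear_maps K V W"
  shows "f \<zero>\<^bsub>V\<^esub> = \<zero>\<^bsub>W\<^esub>"
proof -
  interpret V: module K V by fact
  interpret W: module K W by fact
  have "f (\<zero>\<^bsub>K\<^esub> \<odot>\<^bsub>V\<^esub> \<zero>\<^bsub>V\<^esub>) = \<zero>\<^bsub>K\<^esub> \<odot>\<^bsub>W\<^esub> f \<zero>\<^bsub>V\<^esub>"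
    by (rule linear_mapsD(3)[OF assms(3)]) auto
  then show ?thesis using linear_mapsD(1)[OF assms(3)] by simp
qed

lemma linear_maps_minus:
  assumes "module K V" "module K W" "f \<in> linear_maps K V W" "x \<in> carrier V" "y \<in> carrier V"
  shows "f (x \<ominus>\<^bsub>V\<^esub> y) = f x \<ominus>\<^bsub>W\<^esub> f y"
proof -
  interpret V: module K V by fact
  interpret W: module K W by fact
  note f = linear_mapsD[OF assms(3)]
  have "f (x \<ominus>\<^bsub>V\<^esub> y) \<oplus>\<^bsub>W\<^esub> f y = f x"
    using f(2)[of "x \<ominus>\<^bsub>V\<^esub> y" y] assms(4,5)
    by (simp add: V.minus_eq V.a_assoc V.l_neg)
  then show ?thesis
    by (metis V.minus_closed W.add.inv_solve_right W.minus_eq assms(4,5) f(1))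
qed

lemma linear_maps_equalizer_submodule:
  assumes "module K V" "module K W" "f \<in> linear_maps K V W" "g \<in> linear_maps K V W"
  shows "submodule {x \<in> carrier V. f x = g x} K V"
proof -
  interpret V: module K V by fact
  interpret W: module K W by fact
  note fg = linear_mapsD[OF assms(3)] linear_mapsD[OF assms(4)]
  have z: "f \<zero>\<^bsub>V\<^esub> = \<zero>\<^bsub>W\<^esub>" "g \<zero>\<^bsub>V\<^esub> = \<zero>\<^bsub>W\<^esub>"
    using linear_maps_zero assms by blast+
  show ?thesis
  proof (rule V.submoduleI)
    fix a assume a: "a \<in> {x \<in> carrier V. f x = g x}"
    have "f (\<zero>\<^bsub>V\<^esub> \<ominus>\<^bsub>V\<^esub> a) = g (\<zero>\<^bsub>V\<^esub> \<ominus>\<^bsub>V\<^esub> a)"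
      using a z linear_maps_minus[OF assms(1,2,3)] linear_maps_minus[OF assms(1,2,4)] by simp
    then show "\<ominus>\<^bsub>V\<^esub> a \<in> {x \<in> carrier V. f x = g x}"
      using a by (simp add: V.minus_eq)
  qed (use z fg in auto)
qed

lemma free_space_module:
  fixes K :: "('k, 'p) ring_scheme" and S :: "'i set"
  assumes "cring K" shows "module K (free_space K S)"
proof -
  interpret cring K by fact
  let ?F = "free_space K S"
  have fin: "finite {i. f i \<oplus>\<^bsub>K\<^esub> g i \<noteq> \<zero>\<^bsub>K\<^esub>}"
    if "finite {i. f i \<noteq> \<zero>\<^bsub>K\<^esub>}" "finite {i. g i \<noteq> \<zero>\<^bsub>K\<^esub>}" for f g :: "'i \<Rightarrow> 'k"
    by (rule finite_subset[of _ "{i. f i \<noteq> \<zero>\<^bsub>K\<^esub>} \<union> {i. g i \<noteq> \<zero>\<^bsub>K\<^esub>}"]) (use that in auto)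
  have fin': "finite {i. c \<otimes>\<^bsub>K\<^esub> f i \<noteq> \<zero>\<^bsub>K\<^esub>}"
    if "finite {i. f i \<noteq> \<zero>\<^bsub>K\<^esub>}" "c \<in> carrier K" for f :: "'i \<Rightarrow> 'k" and c
    by (rule finite_subset[of _ "{i. f i \<noteq> \<zero>\<^bsub>K\<^esub>}"]) (use that in auto)
  have neg: "\<exists>y\<in>carrier ?F. y \<oplus>\<^bsub>?F\<^esub> x = \<zero>\<^bsub>?F\<^esub>" if x: "x \<in> carrier ?F" for x
  proof
    have "finite {i. \<ominus>\<^bsub>K\<^esub> x i \<noteq> \<zero>\<^bsub>K\<^esub>}"
      by (rule finite_subset[of _ "{i. x i \<noteq> \<zero>\<^bsub>K\<^esub>}"]) (use x in \<open>auto simp: free_space_def\<close>)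
    then show "(\<lambda>i. \<ominus>\<^bsub>K\<^esub> x i) \<in> carrier ?F"
      using x by (auto simp: free_space_def)
    show "(\<lambda>i. \<ominus>\<^bsub>K\<^esub> x i) \<oplus>\<^bsub>?F\<^esub> x = \<zero>\<^bsub>?F\<^esub>"
      using x by (auto simp: free_space_def l_neg)
  qed
  have "abelian_group ?F"
    by (rule abelian_groupI)
      (use neg in \<open>auto simp: free_space_def fin a_ac\<close>)
  then show ?thesis
    by (intro moduleI assms)
      (auto simp: free_space_def fin' l_distr r_distr m_assoc)
qed

lemma free_basis_closed:
  assumes "cring K" "i \<in> S" shows "free_basis K i \<in> carrier (free_space K S)"
proof -
  interpret cring K by fact
  have "finite {j. free_basis K i j \<noteq> \<zero>\<^bsub>K\<^esub>}"
    by (rule finite_subset[of _ "{i}"]) (auto simp: free_basis_def)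
  then show ?thesis using assms(2) by (auto simp: free_space_def free_basis_def)
qed

lemma free_space_span:
  assumes "cring K" "submodule U K (free_space K S)"
    and basis: "\<And>i. i \<in> S \<Longrightarrow> free_basis K i \<in> U" and "f \<in> carrier (free_space K S)"
  shows "f \<in> U"
proof -
  interpret cring K by fact
  interpret F: module K "free_space K S" by (rule free_space_module) fact
  note U = F.submoduleE[OF assms(2)]
  have zU: "\<zero>\<^bsub>free_space K S\<^esub> \<in> U"
    using subgroup.one_closed[OF submodule.axioms(1)[OF assms(2)]] by simp
  have "f \<in> U" if "finite A" "f \<in> carrier (free_space K S)" "{i. f i \<noteq> \<zero>\<^bsub>K\<^esub>} \<subseteq> A" for A f
    using that
  proof (induction A arbitrary: f rule: finite_induct)
    case empty
    then have "f = \<zero>\<^bsub>free_space K S\<^esub>" by (auto simp: free_space_def)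
    then show ?case using zU by simp
  next
    case (insert i A)
    let ?g = "f(i := \<zero>\<^bsub>K\<^esub>)"
    have "finite {j. ?g j \<noteq> \<zero>\<^bsub>K\<^esub>}"
      by (rule finite_subset[of _ "{i. f i \<noteq> \<zero>\<^bsub>K\<^esub>}"])
        (use insert.prems in \<open>auto simp: free_space_def\<close>)
    then have gF: "?g \<in> carrier (free_space K S)"
      using insert.prems by (auto simp: free_space_def)
    have gU: "?g \<in> U" by (rule insert.IH[OF gF]) (use insert.prems in auto)
    show ?case
    proof (cases "i \<in> S")
      case True
      have "f = ?g \<oplus>\<^bsub>free_space K S\<^esub> f i \<odot>\<^bsub>free_space K S\<^esub> free_basis K i"
        using insert.prems by (auto simp: free_space_def free_basis_def fun_eq_iff)
      also have "\<dots> \<in> U"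
        using insert.prems gU basis[OF True] by (intro U) (auto simp: free_space_def)
      finally show ?thesis .
    next
      case False
      then have "?g = f" using insert.prems by (auto simp: free_space_def)
      then show ?thesis using gU by simp
    qed
  qed
  then show ?thesis using assms(4) by (auto simp: free_space_def)
qed

lemma free_space_lift:
  assumes "module K C" and \<beta>: "\<beta> \<in> S \<rightarrow> carrier C"
  shows "\<exists>f\<in>linear_maps K (free_space K S) C. \<forall>i\<in>S. f (free_basis K i) = \<beta> i"
proof -
  interpret C: module K C by fact
  let ?F = "free_space K S"
  interpret F: module K ?F by (rule free_space_module) unfold_locales
  define L where "L A f = (\<Oplus>\<^bsub>C\<^esub>i\<in>A. f i \<odot>\<^bsub>C\<^esub> \<beta> i)" for A f
  define l where "l f = L {i. f i \<noteq> \<zero>\<^bsub>K\<^esub>} f" for f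
  have clo: "f i \<odot>\<^bsub>C\<^esub> \<beta> i \<in> carrier C" if "f \<in> carrier ?F" "i \<in> S" for f i
    using that \<beta> by (auto simp: free_space_def)
  have lL: "l f = L A f"
    if f: "f \<in> carrier ?F" and A: "finite A" "{i. f i \<noteq> \<zero>\<^bsub>K\<^esub>} \<subseteq> A" "A \<subseteq> S" for f A
    unfolding l_def L_def
  proof (rule C.add.finprod_mono_neutral_cong_left)
    fix i assume "i \<in> A - {i. f i \<noteq> \<zero>\<^bsub>K\<^esub>}"
    then show "f i \<odot>\<^bsub>C\<^esub> \<beta> i = \<zero>\<^bsub>C\<^esub>" using \<beta> A by (auto intro!: C.smult_l_null)
  qed (use A clo[OF f] in auto)
  have supp: "finite {i. f i \<noteq> \<zero>\<^bsub>K\<^esub>}" "{i. f i \<noteq> \<zero>\<^bsub>K\<^esub>} \<subseteq> S" if "f \<in> carrier ?F" for f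
    using that by (auto simp: free_space_def)
  have "l \<in> linear_maps K ?F C"
  proof (rule linear_mapsI)
    fix f assume f: "f \<in> carrier ?F"
    show "l f \<in> carrier C"
      unfolding l_def L_def using clo[OF f] supp[OF f] by (intro C.finsum_closed) auto
  next
    fix f g assume fg: "f \<in> carrier ?F" "g \<in> carrier ?F"
    let ?A = "{i. f i \<noteq> \<zero>\<^bsub>K\<^esub>} \<union> {i. g i \<noteq> \<zero>\<^bsub>K\<^esub>}"
    have A: "finite ?A" "?A \<subseteq> S" using supp fg by auto
    have "l (f \<oplus>\<^bsub>?F\<^esub> g) = L ?A (f \<oplus>\<^bsub>?F\<^esub> g)"
      by (rule lL) (use A fg F.a_closed[OF fg] in \<open>auto simp: free_space_def\<close>)
    also have "\<dots> = (\<Oplus>\<^bsub>C\<^esub>i\<in>?A. f i \<odot>\<^bsub>C\<^esub> \<beta> i \<oplus>\<^bsub>C\<^esub> g i \<odot>\<^bsub>C\<^esub> \<beta> i)"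
      unfolding L_def
    proof (rule C.finsum_cong')
      fix i assume "i \<in> ?A"
      then have "\<beta> i \<in> carrier C" using A(2) \<beta> by blast
      then show "(f \<oplus>\<^bsub>?F\<^esub> g) i \<odot>\<^bsub>C\<^esub> \<beta> i = f i \<odot>\<^bsub>C\<^esub> \<beta> i \<oplus>\<^bsub>C\<^esub> g i \<odot>\<^bsub>C\<^esub> \<beta> i"
        using fg by (auto simp: free_space_def C.smult_l_distr)
    qed (use clo[OF fg(1)] clo[OF fg(2)] A in auto)
    also have "\<dots> = L ?A f \<oplus>\<^bsub>C\<^esub> L ?A g"
      unfolding L_def by (rule C.finsum_addf) (use clo[OF fg(1)] clo[OF fg(2)] A in auto)
    also have "\<dots> = l f \<oplus>\<^bsub>C\<^esub> l g"
      using lL[OF fg(1) A(1)] lL[OF fg(2) A(1)] A(2) by auto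
    finally show "l (f \<oplus>\<^bsub>?F\<^esub> g) = l f \<oplus>\<^bsub>C\<^esub> l g" .
  next
    fix c f assume cf: "c \<in> carrier K" "f \<in> carrier ?F"
    let ?A = "{i. f i \<noteq> \<zero>\<^bsub>K\<^esub>}"
    note A = supp[OF cf(2)]
    have "l (c \<odot>\<^bsub>?F\<^esub> f) = L ?A (c \<odot>\<^bsub>?F\<^esub> f)"
      by (rule lL) (use A cf F.smult_closed[OF cf] in \<open>auto simp: free_space_def\<close>)
    also have "\<dots> = (\<Oplus>\<^bsub>C\<^esub>i\<in>?A. c \<odot>\<^bsub>C\<^esub> (f i \<odot>\<^bsub>C\<^esub> \<beta> i))"
      unfolding L_def
    proof (rule C.finsum_cong')
      fix i assume "i \<in> ?A"
      then have "\<beta> i \<in> carrier C" using A(2) \<beta> by blast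
      then show "(c \<odot>\<^bsub>?F\<^esub> f) i \<odot>\<^bsub>C\<^esub> \<beta> i = c \<odot>\<^bsub>C\<^esub> (f i \<odot>\<^bsub>C\<^esub> \<beta> i)"
        using cf by (auto simp: free_space_def C.smult_assoc1)
    qed (use clo[OF cf(2)] cf A in auto)
    also have "\<dots> = c \<odot>\<^bsub>C\<^esub> l f"
      unfolding l_def L_def
      by (rule C.finsum_smult_ldistr[symmetric]) (use clo[OF cf(2)] cf A in auto)
    finally show "l (c \<odot>\<^bsub>?F\<^esub> f) = c \<odot>\<^bsub>C\<^esub> l f" .
  qed
  moreover have "l (free_basis K i) = \<beta> i" if i: "i \<in> S" for i
  proof -
    have b: "\<beta> i \<in> carrier C" using i \<beta> by auto
    have "l (free_basis K i) = L {i} (free_basis K i)"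
      by (rule lL) (use i in \<open>auto simp: free_basis_def intro!: free_basis_closed[unfolded free_basis_def] C.is_cring\<close>)
    also have "\<dots> = \<beta> i" using b by (simp add: L_def free_basis_def)
    finally show ?thesis .
  qed
  ultimately show ?thesis by blast
qed

lemma quotient_space_props:
  assumes "module K V" "submodule U K V"
  shows quotient_space_module: "module K (quotient_space K V U)"
    and coset_linear: "(\<lambda>x. U +>\<^bsub>V\<^esub> x) \<in> linear_maps K V (quotient_space K V U)"
    and quotient_space_carrier: "carrier (quotient_space K V U) = (\<lambda>x. U +>\<^bsub>V\<^esub> x) ` carrier V"
    and coset_eq_iff: "\<lbrakk>x \<in> carrier V; y \<in> carrier V\<rbrakk> \<Longrightarrow>
           U +>\<^bsub>V\<^esub> x = U +>\<^bsub>V\<^esub> y \<longleftrightarrow> x \<ominus>\<^bsub>V\<^esub> y \<in> U"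
proof -
  interpret V: module K V by fact
  interpret U: submodule U K V by fact
  interpret U: abelian_subgroup U V
    by (rule abelian_subgroupI3) (unfold_locales, simp add: additive_subgroup_def U.subgroup_axioms)
  let ?Q = "quotient_space K V U"
  have carr: "carrier ?Q = (\<lambda>x. U +>\<^bsub>V\<^esub> x) ` carrier V"
    by (auto simp: quotient_space_def A_RCOSETS_def' a_r_coset_def' )
  have eq: "U +>\<^bsub>V\<^esub> x = U +>\<^bsub>V\<^esub> y \<longleftrightarrow> x \<ominus>\<^bsub>V\<^esub> y \<in> U" if "x \<in> carrier V" "y \<in> carrier V" for x y
  proof -
    have "U +>\<^bsub>V\<^esub> x = U +>\<^bsub>V\<^esub> y \<longleftrightarrow> x \<in> U +>\<^bsub>V\<^esub> y"
      using that U.a_rcos_self V.a_repr_independence[OF _ _ U.subgroup_axioms] by metis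
    also have "\<dots> \<longleftrightarrow> x \<ominus>\<^bsub>V\<^esub> y \<in> U"
      using U.a_rcos_module[OF that(2,1)] by (simp add: V.minus_eq)
    finally show ?thesis .
  qed
  have add: "(U +>\<^bsub>V\<^esub> x) \<oplus>\<^bsub>?Q\<^esub> (U +>\<^bsub>V\<^esub> y) = U +>\<^bsub>V\<^esub> (x \<oplus>\<^bsub>V\<^esub> y)"
    if "x \<in> carrier V" "y \<in> carrier V" for x y
    using that by (simp add: quotient_space_def U.a_rcos_sum)
  have smult: "c \<odot>\<^bsub>?Q\<^esub> (U +>\<^bsub>V\<^esub> x) = U +>\<^bsub>V\<^esub> (c \<odot>\<^bsub>V\<^esub> x)"
    if c: "c \<in> carrier K" and x: "x \<in> carrier V" for c x
  proof -
    have "U +>\<^bsub>V\<^esub> (c \<odot>\<^bsub>V\<^esub> y) = U +>\<^bsub>V\<^esub> (c \<odot>\<^bsub>V\<^esub> x)" if y: "y \<in> U +>\<^bsub>V\<^esub> x" for y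
    proof -
      have yV: "y \<in> carrier V" using y x U.a_subset V.a_r_coset_subset_G by blast
      have "y \<ominus>\<^bsub>V\<^esub> x \<in> U"
        using y U.a_rcos_module[OF x yV] by (simp add: V.minus_eq)
      then have "c \<odot>\<^bsub>V\<^esub> (y \<ominus>\<^bsub>V\<^esub> x) \<in> U" using c by simp
      also have "c \<odot>\<^bsub>V\<^esub> (y \<ominus>\<^bsub>V\<^esub> x) = c \<odot>\<^bsub>V\<^esub> y \<ominus>\<^bsub>V\<^esub> c \<odot>\<^bsub>V\<^esub> x"
        using c x yV by (simp add: V.minus_eq V.smult_r_distr V.smult_r_minus)
      finally show ?thesis using eq c x yV by simp
    qed
    note const = this
    have "U +>\<^bsub>V\<^esub> x \<noteq> {}" using U.a_rcos_self[OF x] by blast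
    then have "(\<Union>y\<in>U +>\<^bsub>V\<^esub> x. U +>\<^bsub>V\<^esub> (c \<odot>\<^bsub>V\<^esub> y)) = U +>\<^bsub>V\<^esub> (c \<odot>\<^bsub>V\<^esub> x)"
      by (rule SUP_eq_const) (rule const)
    then show ?thesis by (simp add: quotient_space_def)
  qed
  have zero: "\<zero>\<^bsub>?Q\<^esub> = U +>\<^bsub>V\<^esub> \<zero>\<^bsub>V\<^esub>"
    using U.a_subset by (simp add: quotient_space_def)
  have "abelian_group ?Q"
  proof (rule abelian_groupI)
    fix x assume "x \<in> carrier ?Q"
    then obtain v where v: "v \<in> carrier V" "x = U +>\<^bsub>V\<^esub> v" by (auto simp: carr)
    then show "\<exists>y\<in>carrier ?Q. y \<oplus>\<^bsub>?Q\<^esub> x = \<zero>\<^bsub>?Q\<^esub>"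
      by (intro bexI[of _ "U +>\<^bsub>V\<^esub> (\<ominus>\<^bsub>V\<^esub> v)"]) (auto simp: add zero V.l_neg carr)
  qed (auto simp: carr add zero V.a_ac)
  then show "module K ?Q"
    by (intro moduleI V.is_cring)
      (auto simp: carr add smult V.smult_l_distr V.smult_r_distr V.smult_assoc1)
  show "(\<lambda>x. U +>\<^bsub>V\<^esub> x) \<in> linear_maps K V ?Q"
    by (rule linear_mapsI) (auto simp: carr add smult)
  show "carrier ?Q = (\<lambda>x. U +>\<^bsub>V\<^esub> x) ` carrier V" by (rule carr)
  show "\<lbrakk>x \<in> carrier V; y \<in> carrier V\<rbrakk> \<Longrightarrow>
           U +>\<^bsub>V\<^esub> x = U +>\<^bsub>V\<^esub> y \<longleftrightarrow> x \<ominus>\<^bsub>V\<^esub> y \<in> U" by (rule eq)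
qed

lemma tensor_relators_closed:
  assumes "module K A" "module K B"
  shows "tensor_relators K A B \<subseteq> carrier (free_space K (carrier A \<times> carrier B))"
proof -
  interpret A: module K A by fact
  interpret B: module K B by fact
  interpret F: module K "free_space K (carrier A \<times> carrier B)"
    by (rule free_space_module) (rule A.is_cring)
  show ?thesis
    by (auto simp: tensor_relators_def Let_def
        intro!: free_basis_closed A.is_cring)
qed

lemma tensor_kernel_submodule:
  assumes "module K A" "module K B"
  shows "submodule (tensor_kernel K A B) K (free_space K (carrier A \<times> carrier B))"
proof -
  let ?F = "free_space K (carrier A \<times> carrier B)"
  interpret F: module K ?F
    using assms(1) by (intro free_space_module) (simp add: module_def)
  have "carrier ?F \<in> {U. submodule U K ?F \<and> tensor_relators K A B \<subseteq> U}"
    using F.carrier_is_submodule tensor_relators_closed[OF assms] by simp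
  then have sub: "tensor_kernel K A B \<subseteq> carrier ?F"
    unfolding tensor_kernel_def by (rule Inter_lower)
  have U: "submodule U K ?F" "x \<in> tensor_kernel K A B \<Longrightarrow> x \<in> U"
    if "U \<in> {U. submodule U K ?F \<and> tensor_relators K A B \<subseteq> U}" for U x
    using that by (simp_all add: tensor_kernel_def)
  have I: "x \<in> tensor_kernel K A B"
    if "\<And>U. U \<in> {U. submodule U K ?F \<and> tensor_relators K A B \<subseteq> U} \<Longrightarrow> x \<in> U" for x
    using that unfolding tensor_kernel_def by (rule InterI)
  show ?thesis
  proof (rule F.submoduleI)
    show "\<zero>\<^bsub>?F\<^esub> \<in> tensor_kernel K A B"
      using subgroup.one_closed[OF submodule.axioms(1)[OF U(1)]] by (intro I) simp
  next
    fix x assume "x \<in> tensor_kernel K A B"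
    then show "\<ominus>\<^bsub>?F\<^esub> x \<in> tensor_kernel K A B"
      by - (rule I, rule F.submoduleE(3)[OF U(1)], assumption, rule U(2))
  next
    fix x y assume "x \<in> tensor_kernel K A B" "y \<in> tensor_kernel K A B"
    then show "x \<oplus>\<^bsub>?F\<^esub> y \<in> tensor_kernel K A B"
      by - (rule I, rule F.submoduleE(5)[OF U(1)], assumption, (rule U(2), assumption+)+)
  next
    fix c x assume "c \<in> carrier K" "x \<in> tensor_kernel K A B"
    then show "c \<odot>\<^bsub>?F\<^esub> x \<in> tensor_kernel K A B"
      by - (rule I, rule F.submoduleE(4)[OF U(1)], assumption+, rule U(2))
  qed (rule sub)
qed

lemma tensor_relatorsI:
  fixes K :: "('k, 'p) ring_scheme"
    and A :: "('k, 'a, 'q) module_scheme"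
    and B :: "('k, 'b, 'r) module_scheme"
  defines "F \<equiv> free_space K (carrier A \<times> carrier B)" and "e \<equiv> \<lambda>a b. free_basis K (a, b)"
  shows "\<lbrakk>a \<in> carrier A; a' \<in> carrier A; b \<in> carrier B\<rbrakk> \<Longrightarrow>
      e (a \<oplus>\<^bsub>A\<^esub> a') b \<ominus>\<^bsub>F\<^esub> (e a b \<oplus>\<^bsub>F\<^esub> e a' b) \<in> tensor_relators K A B"
    and "\<lbrakk>a \<in> carrier A; b \<in> carrier B; b' \<in> carrier B\<rbrakk> \<Longrightarrow>
      e a (b \<oplus>\<^bsub>B\<^esub> b') \<ominus>\<^bsub>F\<^esub> (e a b \<oplus>\<^bsub>F\<^esub> e a b') \<in> tensor_relators K A B"
    and "\<lbrakk>c \<in> carrier K; a \<in> carrier A; b \<in> carrier B\<rbrakk> \<Longrightarrow>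
      e (c \<odot>\<^bsub>A\<^esub> a) b \<ominus>\<^bsub>F\<^esub> c \<odot>\<^bsub>F\<^esub> e a b \<in> tensor_relators K A B"
    and "\<lbrakk>c \<in> carrier K; a \<in> carrier A; b \<in> carrier B\<rbrakk> \<Longrightarrow>
      e a (c \<odot>\<^bsub>B\<^esub> b) \<ominus>\<^bsub>F\<^esub> c \<odot>\<^bsub>F\<^esub> e a b \<in> tensor_relators K A B"
  unfolding tensor_relators_def Let_def F_def e_def by blast+

lemma tensor_relators_kernel: "tensor_relators K A B \<subseteq> tensor_kernel K A B"
  by (auto simp: tensor_kernel_def)

lemma tensor_kernel_minimal:
  assumes "submodule U K (free_space K (carrier A \<times> carrier B))" "tensor_relators K A B \<subseteq> U"
  shows "tensor_kernel K A B \<subseteq> U"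
  using assms by (auto simp: tensor_kernel_def)

theorem tensor_space_module:
  assumes "module K A" "module K B" shows "module K (A \<boxtimes>\<^bsub>K\<^esub> B)"
proof -
  have "cring K" using assms(1) by (simp add: module_def)
  then show ?thesis unfolding tensor_space_def
    by (intro quotient_space_module free_space_module tensor_kernel_submodule assms)
qed

theorem pure_tensor_bilinear:
  assumes "module K A" "module K B"
  shows "pure_tensor K A B \<in> bilinear_maps K A B (A \<boxtimes>\<^bsub>K\<^esub> B)"
proof -
  interpret A: module K A by fact
  interpret B: module K B by fact
  let ?F = "free_space K (carrier A \<times> carrier B)" and ?U = "tensor_kernel K A B"
  interpret F: module K ?F by (rule free_space_module) (rule A.is_cring)
  note sub = tensor_kernel_submodule[OF assms]
  note q = linear_mapsD[OF coset_linear[OF F.module_axioms sub], folded tensor_space_def]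
  note eqI = coset_eq_iff[OF F.module_axioms sub, THEN iffD2]
  let ?e = "\<lambda>a b. free_basis K (a, b)"
  have e: "?e a b \<in> carrier ?F" if "a \<in> carrier A" "b \<in> carrier B" for a b
    using that A.is_cring by (intro free_basis_closed) auto
  have rel: "x \<in> tensor_relators K A B \<Longrightarrow> x \<in> ?U" for x
    using tensor_relators_kernel by blast
  have 1: "pure_tensor K A B (a \<oplus>\<^bsub>A\<^esub> a') b =
      pure_tensor K A B a b \<oplus>\<^bsub>A \<boxtimes>\<^bsub>K\<^esub> B\<^esub> pure_tensor K A B a' b"
    if "a \<in> carrier A" "a' \<in> carrier A" "b \<in> carrier B" for a a' b
    unfolding pure_tensor_def q(2)[OF e e, OF that(1,3,2,3), symmetric]
    using that by (intro eqI rel tensor_relatorsI)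
      (simp_all add: e A.a_closed B.a_closed A.smult_closed B.smult_closed)
  have 2: "pure_tensor K A B a (b \<oplus>\<^bsub>B\<^esub> b') =
      pure_tensor K A B a b \<oplus>\<^bsub>A \<boxtimes>\<^bsub>K\<^esub> B\<^esub> pure_tensor K A B a b'"
    if "a \<in> carrier A" "b \<in> carrier B" "b' \<in> carrier B" for a b b'
    unfolding pure_tensor_def q(2)[OF e e, OF that(1,2,1,3), symmetric]
    using that by (intro eqI rel tensor_relatorsI)
      (simp_all add: e A.a_closed B.a_closed A.smult_closed B.smult_closed)
  have 3: "pure_tensor K A B (c \<odot>\<^bsub>A\<^esub> a) b = c \<odot>\<^bsub>A \<boxtimes>\<^bsub>K\<^esub> B\<^esub> pure_tensor K A B a b"
    if "c \<in> carrier K" "a \<in> carrier A" "b \<in> carrier B" for a b c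
    unfolding pure_tensor_def q(3)[OF that(1) e, OF that(2,3), symmetric]
    using that by (intro eqI rel tensor_relatorsI)
      (simp_all add: e A.a_closed B.a_closed A.smult_closed B.smult_closed)
  have 4: "pure_tensor K A B a (c \<odot>\<^bsub>B\<^esub> b) = c \<odot>\<^bsub>A \<boxtimes>\<^bsub>K\<^esub> B\<^esub> pure_tensor K A B a b"
    if "c \<in> carrier K" "a \<in> carrier A" "b \<in> carrier B" for a b c
    unfolding pure_tensor_def q(3)[OF that(1) e, OF that(2,3), symmetric]
    using that by (intro eqI rel tensor_relatorsI)
      (simp_all add: e A.a_closed B.a_closed A.smult_closed B.smult_closed)
  have 5: "pure_tensor K A B a b \<in> carrier (A \<boxtimes>\<^bsub>K\<^esub> B)"
    if "a \<in> carrier A" "b \<in> carrier B" for a b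
    unfolding pure_tensor_def using q(1) e that by blast
  show ?thesis
    unfolding bilinear_maps_def by (auto intro!: linear_mapsI simp: 1 2 3 4 5)
qed

theorem linear_maps_tensor_eqI:
  assumes "module K A" "module K B" "module K C"
    and "f \<in> linear_maps K (A \<boxtimes>\<^bsub>K\<^esub> B) C" "g \<in> linear_maps K (A \<boxtimes>\<^bsub>K\<^esub> B) C"
    and pure: "\<And>a b. \<lbrakk>a \<in> carrier A; b \<in> carrier B\<rbrakk> \<Longrightarrow>
          f (pure_tensor K A B a b) = g (pure_tensor K A B a b)"
    and "x \<in> carrier (A \<boxtimes>\<^bsub>K\<^esub> B)"
  shows "f x = g x"
proof -
  let ?F = "free_space K (carrier A \<times> carrier B)" and ?U = "tensor_kernel K A B"
  have cring: "cring K" using assms(1) by (simp add: module_def)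
  note F = free_space_module[OF cring, of "carrier A \<times> carrier B"]
  note sub = tensor_kernel_submodule[OF assms(1,2)]
  note q = linear_mapsD[OF coset_linear[OF F sub], folded tensor_space_def]
  obtain y where y: "y \<in> carrier ?F" "x = ?U +>\<^bsub>?F\<^esub> y"
    using assms(7) quotient_space_carrier[OF F sub] by (auto simp: tensor_space_def)
  have comp: "(\<lambda>y. h (?U +>\<^bsub>?F\<^esub> y)) \<in> linear_maps K ?F C" if "h \<in> linear_maps K (A \<boxtimes>\<^bsub>K\<^esub> B) C" for h
    by (rule linear_mapsI) (simp_all add: q linear_mapsD[OF that])
  have "y \<in> {y \<in> carrier ?F. f (?U +>\<^bsub>?F\<^esub> y) = g (?U +>\<^bsub>?F\<^esub> y)}"
  proof (rule free_space_span[OF cring])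
    show "submodule {y \<in> carrier ?F. f (?U +>\<^bsub>?F\<^esub> y) = g (?U +>\<^bsub>?F\<^esub> y)} K ?F"
      by (rule linear_maps_equalizer_submodule[OF F assms(3) comp comp]) (rule assms)+
  next
    fix i assume i: "i \<in> carrier A \<times> carrier B"
    then show "free_basis K i \<in> {y \<in> carrier ?F. f (?U +>\<^bsub>?F\<^esub> y) = g (?U +>\<^bsub>?F\<^esub> y)}"
      using free_basis_closed[OF cring i] pure[unfolded pure_tensor_def] by auto
  qed (rule y)
  then show ?thesis using y by simp
qed

lemma tensor_lift_exists:
  assumes "module K A" "module K B" "module K C" "\<beta> \<in> bilinear_maps K A B C"
  shows "\<exists>f\<in>linear_maps K (A \<boxtimes>\<^bsub>K\<^esub> B) C.
    \<forall>a\<in>carrier A. \<forall>b\<in>carrier B. f (pure_tensor K A B a b) = \<beta> a b"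
proof -
  interpret A: module K A by fact
  interpret B: module K B by fact
  interpret C: module K C by fact
  let ?F = "free_space K (carrier A \<times> carrier B)" and ?U = "tensor_kernel K A B"
  interpret F: module K ?F by (rule free_space_module) (rule A.is_cring)
  note sub = tensor_kernel_submodule[OF assms(1,2)]
  note q = linear_mapsD[OF coset_linear[OF F.module_axioms sub], folded tensor_space_def]
  have \<beta>1: "\<beta> a \<in> linear_maps K B C" if "a \<in> carrier A" for a
    using assms(4) that by (auto simp: bilinear_maps_def)
  have \<beta>2: "(\<lambda>a. \<beta> a b) \<in> linear_maps K A C" if "b \<in> carrier B" for b
    using assms(4) that by (auto simp: bilinear_maps_def)
  note \<beta> = linear_mapsD[OF \<beta>1] linear_mapsD[OF \<beta>2]
  have "(\<lambda>(a, b). \<beta> a b) \<in> carrier A \<times> carrier B \<rightarrow> carrier C" using \<beta>(1) by auto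
  from free_space_lift[OF assms(3) this] obtain l
    where l: "l \<in> linear_maps K ?F C"
      and lb: "\<And>a b. \<lbrakk>a \<in> carrier A; b \<in> carrier B\<rbrakk> \<Longrightarrow> l (free_basis K (a, b)) = \<beta> a b"
    by auto
  note ll = linear_mapsD[OF l]
  have e: "free_basis K (a, b) \<in> carrier ?F" if "a \<in> carrier A" "b \<in> carrier B" for a b
    using that A.is_cring by (intro free_basis_closed) auto
  have zlin: "(\<lambda>_. \<zero>\<^bsub>C\<^esub>) \<in> linear_maps K ?F C"
    by (rule linear_mapsI) auto
  have minus: "l (x \<ominus>\<^bsub>?F\<^esub> y) = l x \<ominus>\<^bsub>C\<^esub> l y" if "x \<in> carrier ?F" "y \<in> carrier ?F" for x y
    by (rule linear_maps_minus[OF F.module_axioms assms(3) l that])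
  have "?U \<subseteq> {x \<in> carrier ?F. l x = \<zero>\<^bsub>C\<^esub>}"
  proof (rule tensor_kernel_minimal)
    show "submodule {x \<in> carrier ?F. l x = \<zero>\<^bsub>C\<^esub>} K ?F"
      by (rule linear_maps_equalizer_submodule[OF F.module_axioms assms(3) l zlin])
    show "tensor_relators K A B \<subseteq> {x \<in> carrier ?F. l x = \<zero>\<^bsub>C\<^esub>}"
      using tensor_relators_closed[OF assms(1,2)]
      by (auto simp: tensor_relators_def Let_def minus e ll lb \<beta> C.minus_eq C.r_neg)
  qed
  then have lU: "l x = l y" if "x \<in> carrier ?F" "y \<in> carrier ?F" "?U +>\<^bsub>?F\<^esub> x = ?U +>\<^bsub>?F\<^esub> y" for x y
    using coset_eq_iff[OF F.module_axioms sub that(1,2)] that minus[OF that(1,2)]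
    by (smt (verit) C.minus_eq C.add.inv_closed C.add.inv_equality C.add.inv_inv ll(1) mem_Collect_eq subsetD)
  define f where "f X = l (SOME x. x \<in> carrier ?F \<and> ?U +>\<^bsub>?F\<^esub> x = X)" for X
  have f: "f (?U +>\<^bsub>?F\<^esub> x) = l x" if "x \<in> carrier ?F" for x
    unfolding f_def by (rule someI2[of _ x]) (use that in \<open>auto intro: lU\<close>)
  have carr: "\<exists>x\<in>carrier ?F. X = ?U +>\<^bsub>?F\<^esub> x" if "X \<in> carrier (A \<boxtimes>\<^bsub>K\<^esub> B)" for X
    using that quotient_space_carrier[OF F.module_axioms sub] by (auto simp: tensor_space_def)
  have "f \<in> linear_maps K (A \<boxtimes>\<^bsub>K\<^esub> B) C"
  proof (rule linear_mapsI)
    fix X assume "X \<in> carrier (A \<boxtimes>\<^bsub>K\<^esub> B)"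
    from carr[OF this] show "f X \<in> carrier C" by (auto simp: f ll)
  next
    fix X Y assume "X \<in> carrier (A \<boxtimes>\<^bsub>K\<^esub> B)" "Y \<in> carrier (A \<boxtimes>\<^bsub>K\<^esub> B)"
    from this[THEN carr] obtain x y where "x \<in> carrier ?F" "X = ?U +>\<^bsub>?F\<^esub> x" "y \<in> carrier ?F" "Y = ?U +>\<^bsub>?F\<^esub> y"
      by blast
    then show "f (X \<oplus>\<^bsub>A \<boxtimes>\<^bsub>K\<^esub> B\<^esub> Y) = f X \<oplus>\<^bsub>C\<^esub> f Y" by (simp add: q(2)[symmetric] f ll)
  next
    fix c X assume c: "c \<in> carrier K" and X: "X \<in> carrier (A \<boxtimes>\<^bsub>K\<^esub> B)"
    from carr[OF X] obtain x where "x \<in> carrier ?F" "X = ?U +>\<^bsub>?F\<^esub> x" by blast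
    then show "f (c \<odot>\<^bsub>A \<boxtimes>\<^bsub>K\<^esub> B\<^esub> X) = c \<odot>\<^bsub>C\<^esub> f X" using c by (simp add: q(3)[symmetric] f ll)
  qed
  moreover have "f (pure_tensor K A B a b) = \<beta> a b" if "a \<in> carrier A" "b \<in> carrier B" for a b
    using that by (simp add: pure_tensor_def f e lb)
  ultimately show ?thesis by blast
qed

text \<open>
  The linear map on \<open>A \<boxtimes>\<^bsub>K\<^esub> B\<close> induced by a bilinear map \<open>\<beta>\<close>; existence and uniqueness are
  \<open>tensor_lift_exists\<close> and \<open>linear_maps_tensor_eqI\<close>.
  Sweedler-type notation is rendered by it: if \<open>x = x\<^sub>1 \<otimes> x\<^sub>2\<close> (summation understood), then an
  expression \<open>E x\<^sub>1 x\<^sub>2\<close> with values in \<open>C\<close> is \<open>tensor_lift K A B C (\<lambda>x\<^sub>1 x\<^sub>2. E x\<^sub>1 x\<^sub>2) x\<close>.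
\<close>

definition tensor_lift ::
  "('k, 'p) ring_scheme \<Rightarrow> ('k, 'a, 'q) module_scheme \<Rightarrow> ('k, 'b, 'r) module_scheme \<Rightarrow>
   ('k, 'c, 's) module_scheme \<Rightarrow> ('a \<Rightarrow> 'b \<Rightarrow> 'c) \<Rightarrow> ('a \<times> 'b \<Rightarrow> 'k) set \<Rightarrow> 'c"
  where "tensor_lift K A B C \<beta> =
    (THE f. f \<in> linear_maps K (A \<boxtimes>\<^bsub>K\<^esub> B) C \<and> f \<in> extensional (carrier (A \<boxtimes>\<^bsub>K\<^esub> B)) \<and>
       (\<forall>a\<in>carrier A. \<forall>b\<in>carrier B. f (pure_tensor K A B a b) = \<beta> a b))"

theorem
  assumes "module K A" "module K B" "module K C" "\<beta> \<in> bilinear_maps K A B C"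
  shows tensor_lift_linear: "tensor_lift K A B C \<beta> \<in> linear_maps K (A \<boxtimes>\<^bsub>K\<^esub> B) C"
    and tensor_lift_pure: "\<lbrakk>a \<in> carrier A; b \<in> carrier B\<rbrakk> \<Longrightarrow>
          tensor_lift K A B C \<beta> (pure_tensor K A B a b) = \<beta> a b"
proof -
  let ?T = "A \<boxtimes>\<^bsub>K\<^esub> B"
  let ?P = "\<lambda>f. f \<in> linear_maps K ?T C \<and> f \<in> extensional (carrier ?T) \<and>
       (\<forall>a\<in>carrier A. \<forall>b\<in>carrier B. f (pure_tensor K A B a b) = \<beta> a b)"
  interpret T: module K ?T by (rule tensor_space_module) fact+
  obtain f where f: "f \<in> linear_maps K ?T C"
    "\<forall>a\<in>carrier A. \<forall>b\<in>carrier B. f (pure_tensor K A B a b) = \<beta> a b"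
    using tensor_lift_exists[OF assms] by blast
  have pure: "pure_tensor K A B a b \<in> carrier ?T" if "a \<in> carrier A" "b \<in> carrier B" for a b
    using pure_tensor_bilinear[OF assms(1,2)] that by (auto simp: bilinear_maps_def linear_maps_def)
  have ex: "?P (restrict f (carrier ?T))"
    using f pure by (auto intro!: linear_mapsI simp: linear_mapsD[OF f(1)])
  have uniq: "g = g'" if "?P g" "?P g'" for g g'
  proof (rule extensionalityI[of _ "carrier ?T"])
    fix x assume "x \<in> carrier ?T"
    then show "g x = g' x"
      by (rule linear_maps_tensor_eqI[OF assms(1-3), rotated -1]) (simp_all add: that)
  qed (simp_all add: that)
  have "?P (tensor_lift K A B C \<beta>)"
    unfolding tensor_lift_def by (rule theI[of ?P, OF ex uniq[OF _ ex]])
  then show "tensor_lift K A B C \<beta> \<in> linear_maps K ?T C"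
    and "\<lbrakk>a \<in> carrier A; b \<in> carrier B\<rbrakk> \<Longrightarrow>
          tensor_lift K A B C \<beta> (pure_tensor K A B a b) = \<beta> a b"
    by auto
qed

text \<open>\<open>tensor_map K A B C D f g\<close> is \<open>f \<otimes> g : A \<otimes> B \<rightarrow> C \<otimes> D\<close>.\<close>

definition tensor_map ::
  "('k, 'p) ring_scheme \<Rightarrow> ('k, 'a, 'q) module_scheme \<Rightarrow> ('k, 'b, 'r) module_scheme \<Rightarrow>
   ('k, 'c, 's) module_scheme \<Rightarrow> ('k, 'd, 't) module_scheme \<Rightarrow> ('a \<Rightarrow> 'c) \<Rightarrow> ('b \<Rightarrow> 'd) \<Rightarrow>
   ('a \<times> 'b \<Rightarrow> 'k) set \<Rightarrow> ('c \<times> 'd \<Rightarrow> 'k) set"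
  where "tensor_map K A B C D f g =
    tensor_lift K A B (C \<boxtimes>\<^bsub>K\<^esub> D) (\<lambda>a b. pure_tensor K C D (f a) (g b))"

text \<open>The canonical identification \<open>(A \<otimes> B) \<otimes> C \<rightarrow> A \<otimes> (B \<otimes> C)\<close>.\<close>

definition tensor_assoc ::
  "('k, 'p) ring_scheme \<Rightarrow> ('k, 'a, 'q) module_scheme \<Rightarrow> ('k, 'b, 'r) module_scheme \<Rightarrow>
   ('k, 'c, 's) module_scheme \<Rightarrow>
   (('a \<times> 'b \<Rightarrow> 'k) set \<times> 'c \<Rightarrow> 'k) set \<Rightarrow> ('a \<times> ('b \<times> 'c \<Rightarrow> 'k) set \<Rightarrow> 'k) set"
  where "tensor_assoc K A B C =
    tensor_lift K (A \<boxtimes>\<^bsub>K\<^esub> B) C (A \<boxtimes>\<^bsub>K\<^esub> (B \<boxtimes>\<^bsub>K\<^esub> C)) (\<lambda>x c.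
      tensor_lift K A B (A \<boxtimes>\<^bsub>K\<^esub> (B \<boxtimes>\<^bsub>K\<^esub> C)) (\<lambda>a b.
        pure_tensor K A (B \<boxtimes>\<^bsub>K\<^esub> C) a (pure_tensor K B C b c)) x)"

text \<open>The componentwise multiplication \<open>(a \<otimes> b) (c \<otimes> d) = a c \<otimes> b d\<close> on \<open>H \<otimes> H\<close>.\<close>

definition tensor_mult ::
  "('k, 'p) ring_scheme \<Rightarrow> ('k, 'h, 'q) module_scheme \<Rightarrow> ('h \<Rightarrow> 'h \<Rightarrow> 'h) \<Rightarrow>
   ('h \<times> 'h \<Rightarrow> 'k) set \<Rightarrow> ('h \<times> 'h \<Rightarrow> 'k) set \<Rightarrow> ('h \<times> 'h \<Rightarrow> 'k) set"
  where "tensor_mult K H \<mu> x y =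
    tensor_lift K H H (H \<boxtimes>\<^bsub>K\<^esub> H) (\<lambda>a b.
      tensor_lift K H H (H \<boxtimes>\<^bsub>K\<^esub> H) (\<lambda>c d. pure_tensor K H H (\<mu> a c) (\<mu> b d)) y) x"


section \<open>Hom-bialgebras and Yetter-Drinfeld modules\<close>

text \<open>
  A multiplication \<open>H \<otimes> H \<rightarrow> H\<close> and an action \<open>H \<otimes> M \<rightarrow> M\<close> are given by the corresponding
  bilinear maps \<open>\<mu>\<close> and \<open>act\<close>.  Iterated tensor products are bracketed to the right.
\<close>

locale hom_bialgebra =
  fixes K :: "('k, 'p) ring_scheme"
    and H :: "('k, 'h, 'q) module_scheme"
    and \<mu> :: "'h \<Rightarrow> 'h \<Rightarrow> 'h"
    and \<Delta> :: "'h \<Rightarrow> ('h \<times> 'h \<Rightarrow> 'k) set"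
    and \<alpha> :: "'h \<Rightarrow> 'h"
  assumes base_field: "field K"
    and H_space: "module K H"
    and mult_bilinear: "\<mu> \<in> bilinear_maps K H H H"
    and comult_linear: "\<Delta> \<in> linear_maps K H (H \<boxtimes>\<^bsub>K\<^esub> H)"
    and twist_linear: "\<alpha> \<in> linear_maps K H H"
    and twist_mult: "\<And>h h'. \<lbrakk>h \<in> carrier H; h' \<in> carrier H\<rbrakk> \<Longrightarrow> \<alpha> (\<mu> h h') = \<mu> (\<alpha> h) (\<alpha> h')"
    and hom_assoc: "\<And>h h' h''. \<lbrakk>h \<in> carrier H; h' \<in> carrier H; h'' \<in> carrier H\<rbrakk> \<Longrightarrow>
          \<mu> (\<alpha> h) (\<mu> h' h'') = \<mu> (\<mu> h h') (\<alpha> h'')"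
    and hom_coassoc: "\<And>h. h \<in> carrier H \<Longrightarrow>
          tensor_assoc K H H H (tensor_map K H H (H \<boxtimes>\<^bsub>K\<^esub> H) H \<Delta> \<alpha> (\<Delta> h)) =
          tensor_map K H H H (H \<boxtimes>\<^bsub>K\<^esub> H) \<alpha> \<Delta> (\<Delta> h)"
    and comult_mult: "\<And>h h'. \<lbrakk>h \<in> carrier H; h' \<in> carrier H\<rbrakk> \<Longrightarrow>
          \<Delta> (\<mu> h h') = tensor_mult K H \<mu> (\<Delta> h) (\<Delta> h')"
    and comult_twist: "\<And>h. h \<in> carrier H \<Longrightarrow>
          \<Delta> (\<alpha> h) = tensor_map K H H H H \<alpha> \<alpha> (\<Delta> h)"

locale quasitriangular_hom_bialgebra = hom_bialgebra K H \<mu> \<Delta> \<alpha>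
  for K :: "('k, 'p) ring_scheme"
    and H :: "('k, 'h, 'q) module_scheme"
    and \<mu> \<Delta> \<alpha> +
  fixes R :: "('h \<times> 'h \<Rightarrow> 'k) set"
  assumes R_closed: "R \<in> carrier (H \<boxtimes>\<^bsub>K\<^esub> H)"
    and comult_twist_R:
      "tensor_assoc K H H H (tensor_map K H H (H \<boxtimes>\<^bsub>K\<^esub> H) H \<Delta> \<alpha> R) =
       tensor_lift K H H (H \<boxtimes>\<^bsub>K\<^esub> (H \<boxtimes>\<^bsub>K\<^esub> H)) (\<lambda>R1 R2.
         tensor_lift K H H (H \<boxtimes>\<^bsub>K\<^esub> (H \<boxtimes>\<^bsub>K\<^esub> H)) (\<lambda>r1 r2.
           pure_tensor K H (H \<boxtimes>\<^bsub>K\<^esub> H) (\<alpha> R1) (pure_tensor K H H (\<alpha> r1) (\<mu> R2 r2))) R) R"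
    and twist_comult_R:
      "tensor_map K H H H (H \<boxtimes>\<^bsub>K\<^esub> H) \<alpha> \<Delta> R =
       tensor_lift K H H (H \<boxtimes>\<^bsub>K\<^esub> (H \<boxtimes>\<^bsub>K\<^esub> H)) (\<lambda>R1 R2.
         tensor_lift K H H (H \<boxtimes>\<^bsub>K\<^esub> (H \<boxtimes>\<^bsub>K\<^esub> H)) (\<lambda>r1 r2.
           pure_tensor K H (H \<boxtimes>\<^bsub>K\<^esub> H) (\<mu> R1 r1) (pure_tensor K H H (\<alpha> r2) (\<alpha> R2))) R) R"
    and comult_cop_R: "\<And>h. h \<in> carrier H \<Longrightarrow>
       tensor_mult K H \<mu>
         (tensor_lift K H H (H \<boxtimes>\<^bsub>K\<^esub> H) (\<lambda>h1 h2. pure_tensor K H H h2 h1) (\<Delta> h)) R =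
       tensor_mult K H \<mu> R (\<Delta> h)"

locale hom_module = hom_bialgebra K H \<mu> \<Delta> \<alpha>
  for K :: "('k, 'p) ring_scheme"
    and H :: "('k, 'h, 'q) module_scheme"
    and \<mu> \<Delta> \<alpha> +
  fixes M :: "('k, 'm, 'r) module_scheme"
    and \<alpha>M :: "'m \<Rightarrow> 'm"
    and act :: "'h \<Rightarrow> 'm \<Rightarrow> 'm"
  assumes module_space: "module K M"
    and module_twist_linear: "\<alpha>M \<in> linear_maps K M M"
    and act_bilinear: "act \<in> bilinear_maps K H M M"
    and twist_act: "\<And>h m. \<lbrakk>h \<in> carrier H; m \<in> carrier M\<rbrakk> \<Longrightarrow>
          \<alpha>M (act h m) = act (\<alpha> h) (\<alpha>M m)"
    and act_assoc: "\<And>h h' m. \<lbrakk>h \<in> carrier H; h' \<in> carrier H; m \<in> carrier M\<rbrakk> \<Longrightarrow>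
          act (\<alpha> h) (act h' m) = act (\<mu> h h') (\<alpha>M m)"

locale hom_comodule = hom_bialgebra K H \<mu> \<Delta> \<alpha>
  for K :: "('k, 'p) ring_scheme"
    and H :: "('k, 'h, 'q) module_scheme"
    and \<mu> \<Delta> \<alpha> +
  fixes M :: "('k, 'm, 'r) module_scheme"
    and \<alpha>M :: "'m \<Rightarrow> 'm"
    and coact :: "'m \<Rightarrow> ('h \<times> 'm \<Rightarrow> 'k) set"
  assumes comodule_space: "module K M"
    and comodule_twist_linear: "\<alpha>M \<in> linear_maps K M M"
    and coact_linear: "coact \<in> linear_maps K M (H \<boxtimes>\<^bsub>K\<^esub> M)"
    and twist_coact: "\<And>m. m \<in> carrier M \<Longrightarrow>
          tensor_map K H M H M \<alpha> \<alpha>M (coact m) = coact (\<alpha>M m)"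
    and coact_coassoc: "\<And>m. m \<in> carrier M \<Longrightarrow>
          tensor_assoc K H H M (tensor_map K H M (H \<boxtimes>\<^bsub>K\<^esub> H) M \<Delta> \<alpha>M (coact m)) =
          tensor_map K H M H (H \<boxtimes>\<^bsub>K\<^esub> M) \<alpha> coact (coact m)"

locale yetter_drinfeld_module =
  hom_module K H \<mu> \<Delta> \<alpha> M \<alpha>M act + hom_comodule K H \<mu> \<Delta> \<alpha> M \<alpha>M coact
  for K :: "('k, 'p) ring_scheme"
    and H :: "('k, 'h, 'q) module_scheme"
    and \<mu> \<Delta> \<alpha>
    and M :: "('k, 'm, 'r) module_scheme"
    and \<alpha>M act coact +
  assumes yetter_drinfeld: "\<And>h m. \<lbrakk>h \<in> carrier H; m \<in> carrier M\<rbrakk> \<Longrightarrow>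
    tensor_lift K H H (H \<boxtimes>\<^bsub>K\<^esub> M) (\<lambda>h1 h2.
      tensor_lift K H M (H \<boxtimes>\<^bsub>K\<^esub> M) (\<lambda>x n.
        pure_tensor K H M (\<mu> x (\<alpha> (\<alpha> h2))) n) (coact (act h1 m))) (\<Delta> h) =
    tensor_lift K H H (H \<boxtimes>\<^bsub>K\<^esub> M) (\<lambda>h1 h2.
      tensor_lift K H M (H \<boxtimes>\<^bsub>K\<^esub> M) (\<lambda>x n.
        pure_tensor K H M (\<mu> (\<alpha> (\<alpha> h1)) (\<alpha> x)) (act (\<alpha> h2) n)) (coact m)) (\<Delta> h)"

text \<open>The coaction \<open>m \<mapsto> \<alpha>(R\<^sup>2) \<otimes> R\<^sup>1 \<cdot> m\<close> on a module.\<close>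

definition R_coaction ::
  "('k, 'p) ring_scheme \<Rightarrow> ('k, 'h, 'q) module_scheme \<Rightarrow> ('h \<Rightarrow> 'h) \<Rightarrow> ('h \<times> 'h \<Rightarrow> 'k) set \<Rightarrow>
   ('k, 'm, 'r) module_scheme \<Rightarrow> ('h \<Rightarrow> 'm \<Rightarrow> 'm) \<Rightarrow> 'm \<Rightarrow> ('h \<times> 'm \<Rightarrow> 'k) set"
  where "R_coaction K H \<alpha> R M act m =
    tensor_lift K H H (H \<boxtimes>\<^bsub>K\<^esub> M) (\<lambda>R1 R2. pure_tensor K H M (\<alpha> R2) (act R1 m)) R"

text \<open>The action \<open>h \<cdot> (m \<otimes> n) = h\<^sub>1 \<cdot> m \<otimes> h\<^sub>2 \<cdot> n\<close>.\<close>

definition tensor_action ::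
  "('k, 'p) ring_scheme \<Rightarrow> ('k, 'h, 'q) module_scheme \<Rightarrow> ('h \<Rightarrow> ('h \<times> 'h \<Rightarrow> 'k) set) \<Rightarrow>
   ('k, 'm, 'r) module_scheme \<Rightarrow> ('h \<Rightarrow> 'm \<Rightarrow> 'm) \<Rightarrow>
   ('k, 'n, 's) module_scheme \<Rightarrow> ('h \<Rightarrow> 'n \<Rightarrow> 'n) \<Rightarrow>
   'h \<Rightarrow> ('m \<times> 'n \<Rightarrow> 'k) set \<Rightarrow> ('m \<times> 'n \<Rightarrow> 'k) set"
  where "tensor_action K H \<Delta> M actM N actN h x =
    tensor_lift K H H (M \<boxtimes>\<^bsub>K\<^esub> N) (\<lambda>h1 h2.
      tensor_map K M N M N (actM h1) (actN h2) x) (\<Delta> h)"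

text \<open>
  The coaction
  \<open>m \<otimes> n \<mapsto> \<alpha>\<^sup>-\<^sup>2(m\<^sub>(\<^sub>-\<^sub>1\<^sub>) n\<^sub>(\<^sub>-\<^sub>1\<^sub>)) \<otimes> (m\<^sub>(\<^sub>0\<^sub>) \<otimes> n\<^sub>(\<^sub>0\<^sub>))\<close>
  of the tensor product of Yetter-Drinfeld modules; meaningful for \<open>\<alpha>\<close> bijective on \<open>H\<close>.
\<close>

definition hat_tensor_coaction ::
  "('k, 'p) ring_scheme \<Rightarrow> ('k, 'h, 'q) module_scheme \<Rightarrow> ('h \<Rightarrow> 'h \<Rightarrow> 'h) \<Rightarrow> ('h \<Rightarrow> 'h) \<Rightarrow>
   ('k, 'm, 'r) module_scheme \<Rightarrow> ('m \<Rightarrow> ('h \<times> 'm \<Rightarrow> 'k) set) \<Rightarrow>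
   ('k, 'n, 's) module_scheme \<Rightarrow> ('n \<Rightarrow> ('h \<times> 'n \<Rightarrow> 'k) set) \<Rightarrow>
   ('m \<times> 'n \<Rightarrow> 'k) set \<Rightarrow> ('h \<times> ('m \<times> 'n \<Rightarrow> 'k) set \<Rightarrow> 'k) set"
  where "hat_tensor_coaction K H \<mu> \<alpha> M coactM N coactN =
    (let \<alpha>inv = inv_into (carrier H) \<alpha>; T = H \<boxtimes>\<^bsub>K\<^esub> (M \<boxtimes>\<^bsub>K\<^esub> N) in
      tensor_lift K M N T (\<lambda>m n.
        tensor_lift K H M T (\<lambda>x m0.
          tensor_lift K H N T (\<lambda>y n0.
            pure_tensor K H (M \<boxtimes>\<^bsub>K\<^esub> N) (\<alpha>inv (\<alpha>inv (\<mu> x y))) (pure_tensor K M N m0 n0))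
          (coactN n)) (coactM m)))"

end

theory Submission
  imports Defs
begin

text \<open>
  The map \<open>tensor_lift\<close> behaves like an integral: it commutes with linear maps, and two of them can be
  interchanged.  Sweedler computations thus become chains of equations between iterated
  \<open>tensor_lift\<close>s, whose multilinearity side conditions are left to the simplifier.
  As \<open>(\<alpha> \<otimes> \<alpha>)(R) = R\<close>, a sum over \<open>R\<close> may be twisted by \<open>\<alpha>\<close> at will, which is what makes
  Hom-associativity applicable.  Coassociativity of \<open>m \<mapsto> \<alpha>(R\<^sup>2) \<otimes> R\<^sup>1 \<cdot> m\<close> then comes from
  \<open>(\<alpha> \<otimes> \<Delta>)(R)\<close>, the Yetter-Drinfeld condition from \<open>\<Delta>\<^sup>c\<^sup>o\<^sup>p(h) R = R \<Delta>(h)\<close>, and the equality of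
  the two coactions on \<open>M \<otimes> N\<close> from \<open>(\<Delta> \<otimes> \<alpha>)(R)\<close>.
\<close>

section \<open>Calculus of Sweedler sums\<close>

text \<open>Mostly used as conditional rewrite rules for side conditions. Linearity facts are stated
  for composites such as \<open>\<lambda>x. f (t x)\<close>, so that the outermost operation is
  stripped off and \<open>linear_maps_id\<close> ends the recursion.\<close>

named_theorems multilinear

lemma linear_maps_id [multilinear]: "(\<lambda>x. x) \<in> linear_maps K V V"
  by (rule linear_mapsI) auto

text \<open>Kept out of \<open>multilinear\<close> in this generality, where the splitting of a
  function into \<open>f\<close> and \<open>t\<close> is ambiguous; instances with a known outer map
  \<open>f\<close> are added instead.\<close>

lemma linear_maps_compose:
  assumes "f \<in> linear_maps K V W" "t \<in> linear_maps K U V"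
  shows "(\<lambda>x. f (t x)) \<in> linear_maps K U W"
  using assms by (auto simp: linear_maps_def Pi_iff)

lemma bilinear_mapsI [multilinear]:
  assumes "\<And>u. u \<in> carrier U \<Longrightarrow> (\<lambda>v. \<beta> u v) \<in> linear_maps K V W"
    and "\<And>v. v \<in> carrier V \<Longrightarrow> (\<lambda>u. \<beta> u v) \<in> linear_maps K U W"
  shows "\<beta> \<in> bilinear_maps K U V W"
  using assms by (simp add: bilinear_maps_def)

lemma bilinear_mapsD:
  assumes "\<beta> \<in> bilinear_maps K U V W"
  shows bilinear_maps_right: "u \<in> carrier U \<Longrightarrow> \<beta> u \<in> linear_maps K V W"
    and bilinear_maps_left: "v \<in> carrier V \<Longrightarrow> (\<lambda>u. \<beta> u v) \<in> linear_maps K U W"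
  using assms by (simp_all add: bilinear_maps_def)

lemma bilinear_maps_closed:
  assumes "\<beta> \<in> bilinear_maps K U V W" "u \<in> carrier U" "v \<in> carrier V"
  shows "\<beta> u v \<in> carrier W"
  using linear_mapsD(1)[OF bilinear_maps_right[OF assms(1,2)] assms(3)] .

lemma bilinear_compose_left:
  assumes "\<beta> \<in> bilinear_maps K V V' W" "t \<in> linear_maps K U V" "c \<in> carrier V'"
  shows "(\<lambda>x. \<beta> (t x) c) \<in> linear_maps K U W"
  by (rule linear_maps_compose[OF bilinear_maps_left]) fact+

lemma bilinear_compose_right:
  assumes "\<beta> \<in> bilinear_maps K V V' W" "t \<in> linear_maps K U V'" "c \<in> carrier V"
  shows "(\<lambda>x. \<beta> c (t x)) \<in> linear_maps K U W"
  by (rule linear_maps_compose[OF bilinear_maps_right]) fact+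

section \<open>Rules for pure tensors and induced maps\<close>

lemmas [multilinear] = tensor_space_module

lemma pure_tensor_closed [multilinear]:
  assumes "module K A" "module K B" "a \<in> carrier A" "b \<in> carrier B"
  shows "pure_tensor K A B a b \<in> carrier (A \<boxtimes>\<^bsub>K\<^esub> B)"
  by (rule bilinear_maps_closed[OF pure_tensor_bilinear]) fact+

lemma pure_tensor_linear_left [multilinear]:
  assumes "module K A" "module K B" "t \<in> linear_maps K U A" "b \<in> carrier B"
  shows "(\<lambda>x. pure_tensor K A B (t x) b) \<in> linear_maps K U (A \<boxtimes>\<^bsub>K\<^esub> B)"
  by (rule bilinear_compose_left[OF pure_tensor_bilinear]) fact+

lemma pure_tensor_linear_right [multilinear]:
  assumes "module K A" "module K B" "t \<in> linear_maps K U B" "a \<in> carrier A"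
  shows "(\<lambda>x. pure_tensor K A B a (t x)) \<in> linear_maps K U (A \<boxtimes>\<^bsub>K\<^esub> B)"
  by (rule bilinear_compose_right[OF pure_tensor_bilinear]) fact+

lemma tensor_lift_closed [multilinear]:
  assumes "module K A" "module K B" "module K C" "\<beta> \<in> bilinear_maps K A B C"
    and "x \<in> carrier (A \<boxtimes>\<^bsub>K\<^esub> B)"
  shows "tensor_lift K A B C \<beta> x \<in> carrier C"
  by (rule linear_mapsD(1)[OF tensor_lift_linear]) fact+

lemma tensor_lift_linear_arg [multilinear]:
  assumes "module K A" "module K B" "module K C" "\<beta> \<in> bilinear_maps K A B C"
    and "t \<in> linear_maps K U (A \<boxtimes>\<^bsub>K\<^esub> B)"
  shows "(\<lambda>x. tensor_lift K A B C \<beta> (t x)) \<in> linear_maps K U C"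
  by (rule linear_maps_compose[OF tensor_lift_linear]) fact+

text \<open>The uniqueness half of the universal property, in the form used below: an expression is
  recognized as an induced map by its linearity and its values on pure tensors.\<close>

lemma tensor_lift_unique:
  assumes "module K A" "module K B" "module K C" "\<beta> \<in> bilinear_maps K A B C"
    and "f \<in> linear_maps K (A \<boxtimes>\<^bsub>K\<^esub> B) C"
    and "\<And>a b. \<lbrakk>a \<in> carrier A; b \<in> carrier B\<rbrakk> \<Longrightarrow> f (pure_tensor K A B a b) = \<beta> a b"
    and "x \<in> carrier (A \<boxtimes>\<^bsub>K\<^esub> B)"
  shows "f x = tensor_lift K A B C \<beta> x"
  by (rule linear_maps_tensor_eqI[OF assms(1-3,5) tensor_lift_linear[OF assms(1-4)] _ assms(7)])
    (simp add: assms tensor_lift_pure)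

text \<open>The description defining \<open>tensor_lift\<close> refers to the bilinear map only
  through its values on the carriers. As a congruence rule this hands the simplifier
  \<open>a \<in> carrier A\<close> and \<open>b \<in> carrier B\<close> under the binders, where the
  conditional rules need them.\<close>

lemma tensor_lift_cong [cong]:
  assumes "x = y" and "\<And>a b. \<lbrakk>a \<in> carrier A; b \<in> carrier B\<rbrakk> \<Longrightarrow> \<beta> a b = \<gamma> a b"
  shows "tensor_lift K A B C \<beta> x = tensor_lift K A B C \<gamma> y"
proof -
  have "tensor_lift K A B C \<beta> = tensor_lift K A B C \<gamma>"
    unfolding tensor_lift_def using assms(2) by (metis (no_types, lifting))
  then show ?thesis using assms(1) by simp
qed

text \<open>The counterpart of pulling a linear map into a finite sum: the composite with
  \<open>f\<close> is linear and sends a pure tensor to \<open>f (\<beta> a b)\<close>, so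
  uniqueness applies.\<close>

lemma linear_maps_tensor_lift:
  assumes "module K A" "module K B" "module K C" "module K D" "\<beta> \<in> bilinear_maps K A B C"
    and "f \<in> linear_maps K C D" "x \<in> carrier (A \<boxtimes>\<^bsub>K\<^esub> B)"
  shows "f (tensor_lift K A B C \<beta> x) = tensor_lift K A B D (\<lambda>a b. f (\<beta> a b)) x"
  by (rule tensor_lift_unique[where f = "\<lambda>x. f (tensor_lift K A B C \<beta> x)"])
    (auto intro!: multilinear assms linear_maps_compose[OF assms(6)] bilinear_mapsD[OF assms(5)]
      simp: tensor_lift_pure assms(1-5))

lemma tensor_lift_add:
  assumes "module K A" "module K B" "module K C"
    and "\<beta> \<in> bilinear_maps K A B C" "\<gamma> \<in> bilinear_maps K A B C" "x \<in> carrier (A \<boxtimes>\<^bsub>K\<^esub> B)"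
  shows "tensor_lift K A B C (\<lambda>a b. \<beta> a b \<oplus>\<^bsub>C\<^esub> \<gamma> a b) x =
    tensor_lift K A B C \<beta> x \<oplus>\<^bsub>C\<^esub> tensor_lift K A B C \<gamma> x"
proof -
  interpret C: module K C by fact
  \<comment> \<open>\<open>V\<close> is left open because the fact is applied to each factor and to
    the tensor product.\<close>
  have add: "(\<lambda>x. f x \<oplus>\<^bsub>C\<^esub> g x) \<in> linear_maps K V C"
    if "f \<in> linear_maps K V C" "g \<in> linear_maps K V C" for f g and V :: "('a, 'x, 'y) module_scheme"
    using linear_mapsD[OF that(1)] linear_mapsD[OF that(2)]
    by (intro linear_mapsI) (auto simp: C.smult_r_distr C.a_ac)
  show ?thesis
    by (rule tensor_lift_unique[symmetric,
          where f = "\<lambda>x. tensor_lift K A B C \<beta> x \<oplus>\<^bsub>C\<^esub> tensor_lift K A B C \<gamma> x"])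
      (auto intro!: assms add bilinear_mapsI tensor_lift_linear
        intro: bilinear_mapsD[OF assms(4)] bilinear_mapsD[OF assms(5)]
        simp: tensor_lift_pure assms(1-5))
qed

lemma tensor_lift_smult:
  assumes "module K A" "module K B" "module K C"
    and "\<beta> \<in> bilinear_maps K A B C" "c \<in> carrier K" "x \<in> carrier (A \<boxtimes>\<^bsub>K\<^esub> B)"
  shows "tensor_lift K A B C (\<lambda>a b. c \<odot>\<^bsub>C\<^esub> \<beta> a b) x = c \<odot>\<^bsub>C\<^esub> tensor_lift K A B C \<beta> x"
proof -
  interpret C: module K C by fact
  have "(\<lambda>y. c \<odot>\<^bsub>C\<^esub> y) \<in> linear_maps K C C"
    using assms(5) by (intro linear_mapsI) (auto simp: C.smult_r_distr C.smult_assoc1[symmetric] C.m_comm)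
  from linear_maps_tensor_lift[OF assms(1-3,3,4) this assms(6)] show ?thesis by simp
qed

text \<open>Provides the side conditions for nested sums, where the summand of the inner sum depends
  on the outer variables. Dependence through the summed element is covered by
  \<open>tensor_lift_linear_arg\<close>.\<close>

lemma tensor_lift_linear_param [multilinear]:
  assumes "module K A" "module K B" "module K C" "module K U"
    and x: "x \<in> carrier (A \<boxtimes>\<^bsub>K\<^esub> B)"
    and lin: "\<And>a b. \<lbrakk>a \<in> carrier A; b \<in> carrier B\<rbrakk> \<Longrightarrow> (\<lambda>u. \<beta> u a b) \<in> linear_maps K U C"
    and bil: "\<And>u. u \<in> carrier U \<Longrightarrow> \<beta> u \<in> bilinear_maps K A B C"
  shows "(\<lambda>u. tensor_lift K A B C (\<beta> u) x) \<in> linear_maps K U C"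
proof -
  interpret U: module K U by fact
  show ?thesis
  proof (rule linear_mapsI)
    fix u v assume uv: "u \<in> carrier U" "v \<in> carrier U"
    have "tensor_lift K A B C (\<beta> (u \<oplus>\<^bsub>U\<^esub> v)) x =
        tensor_lift K A B C (\<lambda>a b. \<beta> u a b \<oplus>\<^bsub>C\<^esub> \<beta> v a b) x"
      using linear_mapsD(2)[OF lin] uv by (intro tensor_lift_cong) auto
    then show "tensor_lift K A B C (\<beta> (u \<oplus>\<^bsub>U\<^esub> v)) x =
        tensor_lift K A B C (\<beta> u) x \<oplus>\<^bsub>C\<^esub> tensor_lift K A B C (\<beta> v) x"
      using tensor_lift_add[OF assms(1-3) bil bil x] uv by simp
  next
    fix c u assume cu: "c \<in> carrier K" "u \<in> carrier U"
    have "tensor_lift K A B C (\<beta> (c \<odot>\<^bsub>U\<^esub> u)) x = tensor_lift K A B C (\<lambda>a b. c \<odot>\<^bsub>C\<^esub> \<beta> u a b) x"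
      using linear_mapsD(3)[OF lin] cu by (intro tensor_lift_cong) auto
    then show "tensor_lift K A B C (\<beta> (c \<odot>\<^bsub>U\<^esub> u)) x = c \<odot>\<^bsub>C\<^esub> tensor_lift K A B C (\<beta> u) x"
      using tensor_lift_smult[OF assms(1-3) bil _ x] cu by simp
  qed (intro tensor_lift_closed assms)
qed

text \<open>Fubini for Sweedler sums. With \<open>y\<close> fixed, the right-hand side is linear in
  \<open>x\<close>, and on a pure tensor its inner sum evaluates to \<open>\<beta> a b c d\<close>;
  uniqueness identifies it with the left-hand side.\<close>

lemma tensor_lift_swap:
  assumes "module K A" "module K B" "module K C" "module K D" "module K E"
    and x: "x \<in> carrier (A \<boxtimes>\<^bsub>K\<^esub> B)" and y: "y \<in> carrier (C \<boxtimes>\<^bsub>K\<^esub> D)"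
    and 1: "\<And>a b. \<lbrakk>a \<in> carrier A; b \<in> carrier B\<rbrakk> \<Longrightarrow> \<beta> a b \<in> bilinear_maps K C D E"
    and 2: "\<And>c d. \<lbrakk>c \<in> carrier C; d \<in> carrier D\<rbrakk> \<Longrightarrow>
              (\<lambda>a b. \<beta> a b c d) \<in> bilinear_maps K A B E"
  shows "tensor_lift K A B E (\<lambda>a b. tensor_lift K C D E (\<beta> a b) y) x =
    tensor_lift K C D E (\<lambda>c d. tensor_lift K A B E (\<lambda>a b. \<beta> a b c d) x) y"
proof (rule tensor_lift_unique[symmetric,
    where f = "\<lambda>x. tensor_lift K C D E (\<lambda>c d. tensor_lift K A B E (\<lambda>a b. \<beta> a b c d) x) y"])
  show "(\<lambda>a b. tensor_lift K C D E (\<beta> a b) y) \<in> bilinear_maps K A B E"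
    by (intro bilinear_mapsI tensor_lift_linear_param assms)
      (auto intro: bilinear_mapsD[OF 2])
  show "(\<lambda>x. tensor_lift K C D E (\<lambda>c d. tensor_lift K A B E (\<lambda>a b. \<beta> a b c d) x) y)
      \<in> linear_maps K (A \<boxtimes>\<^bsub>K\<^esub> B) E"
    by (intro bilinear_mapsI tensor_lift_linear_param tensor_lift_linear tensor_space_module assms)
      (auto intro: bilinear_mapsD[OF 1])
  show "tensor_lift K C D E (\<lambda>c d. tensor_lift K A B E (\<lambda>a b. \<beta> a b c d) (pure_tensor K A B a b)) y
      = tensor_lift K C D E (\<beta> a b) y" if "a \<in> carrier A" "b \<in> carrier B" for a b
    using that by (intro tensor_lift_cong) (simp_all add: tensor_lift_pure assms)
qed (use assms in auto)

text \<open>Here and in the next lemma the outer map of \<open>linear_maps_tensor_lift\<close> is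
  specialized, which gives rewrite rules moving inner sums outwards. Repeated use flattens a
  Sweedler expression to an iterated sum.\<close>

lemma tensor_lift_tensor_lift:
  assumes "module K A" "module K B" "module K C" "module K D" "module K E"
    and "\<beta> \<in> bilinear_maps K A B (C \<boxtimes>\<^bsub>K\<^esub> D)" "\<gamma> \<in> bilinear_maps K C D E"
    and "x \<in> carrier (A \<boxtimes>\<^bsub>K\<^esub> B)"
  shows "tensor_lift K C D E \<gamma> (tensor_lift K A B (C \<boxtimes>\<^bsub>K\<^esub> D) \<beta> x) =
    tensor_lift K A B E (\<lambda>a b. tensor_lift K C D E \<gamma> (\<beta> a b)) x"
  by (rule linear_maps_tensor_lift) (intro assms multilinear tensor_lift_linear)+

lemma pure_tensor_tensor_lift:
  assumes "module K A" "module K B" "module K C" "module K D"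
    and "\<beta> \<in> bilinear_maps K A B C" "x \<in> carrier (A \<boxtimes>\<^bsub>K\<^esub> B)" "d \<in> carrier D"
  shows "pure_tensor K D C d (tensor_lift K A B C \<beta> x) =
    tensor_lift K A B (D \<boxtimes>\<^bsub>K\<^esub> C) (\<lambda>a b. pure_tensor K D C d (\<beta> a b)) x"
  by (rule linear_maps_tensor_lift) (intro assms multilinear)+

lemma tensor_lift_tensor_map:
  assumes "module K A" "module K B" "module K C" "module K D" "module K E"
    and "f \<in> linear_maps K A C" "g \<in> linear_maps K B D" "\<gamma> \<in> bilinear_maps K C D E"
    and "x \<in> carrier (A \<boxtimes>\<^bsub>K\<^esub> B)"
  shows "tensor_lift K C D E \<gamma> (tensor_map K A B C D f g x) =
    tensor_lift K A B E (\<lambda>a b. \<gamma> (f a) (g b)) x"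
proof -
  have "(\<lambda>a b. pure_tensor K C D (f a) (g b)) \<in> bilinear_maps K A B (C \<boxtimes>\<^bsub>K\<^esub> D)"
    by (intro multilinear assms linear_mapsD(1)[OF assms(6)] linear_mapsD(1)[OF assms(7)])
  then show ?thesis
    by (simp add: tensor_map_def tensor_lift_tensor_lift tensor_lift_pure assms
        linear_mapsD(1)[OF assms(6)] linear_mapsD(1)[OF assms(7)])
qed

lemmas tensor_lift_simps = tensor_lift_pure tensor_lift_tensor_lift pure_tensor_tensor_lift

section \<open>Linearity rules for the structure maps\<close>

context hom_bialgebra
begin

lemmas [multilinear] = H_space comult_linear twist_linear
  linear_mapsD(1)[OF comult_linear] linear_mapsD(1)[OF twist_linear]
  linear_maps_compose[OF comult_linear] linear_maps_compose[OF twist_linear]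
  bilinear_maps_closed[OF mult_bilinear]
  bilinear_compose_left[OF mult_bilinear] bilinear_compose_right[OF mult_bilinear]

end

section \<open>The axioms of \<open>R\<close> as identities between sums\<close>

context quasitriangular_hom_bialgebra
begin

lemmas [multilinear] = R_closed

text \<open>A trilinear \<open>F\<close> induces a linear map \<open>?G\<close> on H \<otimes> (H
  \<otimes> H); it is applied to both sides of \<open>twist_comult_R\<close> and the results are
  flattened.\<close>

lemma tensor_lift_twist_comult_R:
  assumes E: "module K E"
    and F1: "\<And>b c. \<lbrakk>b \<in> carrier H; c \<in> carrier H\<rbrakk> \<Longrightarrow> (\<lambda>a. F a b c) \<in> linear_maps K H E"
    and F2: "\<And>a c. \<lbrakk>a \<in> carrier H; c \<in> carrier H\<rbrakk> \<Longrightarrow> (\<lambda>b. F a b c) \<in> linear_maps K H E"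
    and F3: "\<And>a b. \<lbrakk>a \<in> carrier H; b \<in> carrier H\<rbrakk> \<Longrightarrow> (\<lambda>c. F a b c) \<in> linear_maps K H E"
  shows "tensor_lift K H H E (\<lambda>R1 R2. tensor_lift K H H E (F (\<alpha> R1)) (\<Delta> R2)) R =
    tensor_lift K H H E (\<lambda>R1 R2. tensor_lift K H H E (\<lambda>r1 r2. F (\<mu> R1 r1) (\<alpha> r2) (\<alpha> R2)) R) R"
proof -
  let ?G = "tensor_lift K H (H \<boxtimes>\<^bsub>K\<^esub> H) E (\<lambda>a. tensor_lift K H H E (F a))"
  \<comment> \<open>\<open>F\<close> is a variable, so the composite forms that
    \<open>multilinear\<close> holds for the structure maps are made by hand.\<close>
  note C1 = linear_maps_compose[OF F1] linear_maps_compose[OF F2] linear_maps_compose[OF F3]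
  have "?G (tensor_map K H H H (H \<boxtimes>\<^bsub>K\<^esub> H) \<alpha> \<Delta> R) =
    tensor_lift K H H E (\<lambda>R1 R2. tensor_lift K H H E (F (\<alpha> R1)) (\<Delta> R2)) R"
    by (simp add: tensor_map_def tensor_lift_simps multilinear E F1 F2 F3 C1)
  moreover have "?G (tensor_lift K H H (H \<boxtimes>\<^bsub>K\<^esub> (H \<boxtimes>\<^bsub>K\<^esub> H)) (\<lambda>R1 R2.
         tensor_lift K H H (H \<boxtimes>\<^bsub>K\<^esub> (H \<boxtimes>\<^bsub>K\<^esub> H)) (\<lambda>r1 r2.
           pure_tensor K H (H \<boxtimes>\<^bsub>K\<^esub> H) (\<mu> R1 r1) (pure_tensor K H H (\<alpha> r2) (\<alpha> R2))) R) R) =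
     tensor_lift K H H E (\<lambda>R1 R2. tensor_lift K H H E (\<lambda>r1 r2. F (\<mu> R1 r1) (\<alpha> r2) (\<alpha> R2)) R) R"
    by (simp add: tensor_lift_simps multilinear E F1 F2 F3 C1)
  ultimately show ?thesis by (simp add: twist_comult_R)
qed

text \<open>The same map \<open>?G\<close>, applied to \<open>comult_twist_R\<close>; the inner sum
  over \<open>\<Delta> R1\<close> arises from unfolding the rebracketing
  \<open>tensor_assoc\<close>.\<close>

lemma tensor_lift_comult_twist_R:
  assumes E: "module K E"
    and F1: "\<And>b c. \<lbrakk>b \<in> carrier H; c \<in> carrier H\<rbrakk> \<Longrightarrow> (\<lambda>a. F a b c) \<in> linear_maps K H E"
    and F2: "\<And>a c. \<lbrakk>a \<in> carrier H; c \<in> carrier H\<rbrakk> \<Longrightarrow> (\<lambda>b. F a b c) \<in> linear_maps K H E"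
    and F3: "\<And>a b. \<lbrakk>a \<in> carrier H; b \<in> carrier H\<rbrakk> \<Longrightarrow> (\<lambda>c. F a b c) \<in> linear_maps K H E"
  shows "tensor_lift K H H E (\<lambda>R1 R2. tensor_lift K H H E (\<lambda>a b. F a b (\<alpha> R2)) (\<Delta> R1)) R =
    tensor_lift K H H E (\<lambda>R1 R2. tensor_lift K H H E (\<lambda>r1 r2. F (\<alpha> R1) (\<alpha> r1) (\<mu> R2 r2)) R) R"
proof -
  let ?G = "tensor_lift K H (H \<boxtimes>\<^bsub>K\<^esub> H) E (\<lambda>a. tensor_lift K H H E (F a))"
  note C1 = linear_maps_compose[OF F1] linear_maps_compose[OF F2] linear_maps_compose[OF F3]
  have "?G (tensor_assoc K H H H (tensor_map K H H (H \<boxtimes>\<^bsub>K\<^esub> H) H \<Delta> \<alpha> R)) =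
    tensor_lift K H H E (\<lambda>R1 R2. tensor_lift K H H E (\<lambda>a b. F a b (\<alpha> R2)) (\<Delta> R1)) R"
    by (simp add: tensor_map_def tensor_assoc_def tensor_lift_simps multilinear E F1 F2 F3 C1)
  moreover have "?G (tensor_lift K H H (H \<boxtimes>\<^bsub>K\<^esub> (H \<boxtimes>\<^bsub>K\<^esub> H)) (\<lambda>R1 R2.
         tensor_lift K H H (H \<boxtimes>\<^bsub>K\<^esub> (H \<boxtimes>\<^bsub>K\<^esub> H)) (\<lambda>r1 r2.
           pure_tensor K H (H \<boxtimes>\<^bsub>K\<^esub> H) (\<alpha> R1) (pure_tensor K H H (\<alpha> r1) (\<mu> R2 r2))) R) R) =
     tensor_lift K H H E (\<lambda>R1 R2. tensor_lift K H H E (\<lambda>r1 r2. F (\<alpha> R1) (\<alpha> r1) (\<mu> R2 r2)) R) R"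
    by (simp add: tensor_lift_simps multilinear E F1 F2 F3 C1)
  ultimately show ?thesis by (simp add: comult_twist_R)
qed

text \<open>The map induced by \<open>F\<close>, applied to \<open>comult_cop_R\<close>. As
  \<open>tensor_mult\<close> sums over its first factor outside, the two sides are nested
  differently.\<close>

lemma tensor_lift_comult_cop_R:
  assumes E: "module K E" and F: "F \<in> bilinear_maps K H H E" and h: "h \<in> carrier H"
  shows "tensor_lift K H H E (\<lambda>h1 h2.
      tensor_lift K H H E (\<lambda>R1 R2. F (\<mu> h2 R1) (\<mu> h1 R2)) R) (\<Delta> h) =
    tensor_lift K H H E (\<lambda>R1 R2.
      tensor_lift K H H E (\<lambda>h1 h2. F (\<mu> R1 h1) (\<mu> R2 h2)) (\<Delta> h)) R"
  using arg_cong[OF comult_cop_R[OF h], of "tensor_lift K H H E F"]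
  by (simp add: tensor_mult_def tensor_lift_simps multilinear E F h bilinear_maps_closed[OF F]
      bilinear_compose_left[OF F] bilinear_compose_right[OF F])

end

context hom_module
begin

lemmas [multilinear] = module_space module_twist_linear
  linear_mapsD(1)[OF module_twist_linear] linear_maps_compose[OF module_twist_linear]
  bilinear_maps_closed[OF act_bilinear]
  bilinear_compose_left[OF act_bilinear] bilinear_compose_right[OF act_bilinear]

end

section \<open>The Yetter-Drinfeld module of a module\<close>

locale twist_invariant_quasitriangular = quasitriangular_hom_bialgebra +
  assumes twist_R: "tensor_map K H H H H \<alpha> \<alpha> R = R"
begin

text \<open>The substitution rule \<open>tensor_lift_tensor_map\<close> at \<open>R\<close>. Both
  legs gain or lose an \<open>\<alpha>\<close> together, so each use names an \<open>F\<close> that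
  absorbs every other \<open>\<alpha>\<close>.\<close>

lemma tensor_lift_twist_R:
  assumes "module K E" "F \<in> bilinear_maps K H H E"
  shows "tensor_lift K H H E (\<lambda>R1 R2. F (\<alpha> R1) (\<alpha> R2)) R = tensor_lift K H H E F R"
  using tensor_lift_tensor_map[OF H_space H_space H_space H_space assms(1) twist_linear twist_linear
      assms(2) R_closed]
  by (simp add: twist_R)

lemma R_coaction_yetter_drinfeld:
  assumes "hom_module K H \<mu> \<Delta> \<alpha> M \<alpha>M act"
  shows "yetter_drinfeld_module K H \<mu> \<Delta> \<alpha> M \<alpha>M act (R_coaction K H \<alpha> R M act)"
proof -
  interpret M: hom_module K H \<mu> \<Delta> \<alpha> M \<alpha>M act by fact
  note simps = tensor_map_def tensor_assoc_def R_coaction_def tensor_lift_simps multilinear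
  let ?co = "R_coaction K H \<alpha> R M act"
  have linear: "?co \<in> linear_maps K M (H \<boxtimes>\<^bsub>K\<^esub> M)"
    unfolding R_coaction_def by (simp add: simps)
  \<comment> \<open>\<open>twist_act\<close> moves \<open>\<alpha>M\<close> past the action, so both
    legs of \<open>R\<close> carry one extra \<open>\<alpha>\<close>, which the invariance of
    \<open>R\<close> removes.\<close>
  have twist: "tensor_map K H M H M \<alpha> \<alpha>M (?co m) = ?co (\<alpha>M m)" if m: "m \<in> carrier M" for m
  proof -
    have "tensor_map K H M H M \<alpha> \<alpha>M (?co m) = tensor_lift K H H (H \<boxtimes>\<^bsub>K\<^esub> M)
        (\<lambda>R1 R2. pure_tensor K H M (\<alpha> (\<alpha> R2)) (act (\<alpha> R1) (\<alpha>M m))) R"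
      using m by (simp add: simps M.twist_act)
    also have "\<dots> = ?co (\<alpha>M m)"
      unfolding R_coaction_def
      by (rule tensor_lift_twist_R[where F = "\<lambda>R1 R2. pure_tensor K H M (\<alpha> R2) (act R1 (\<alpha>M m))"])
        (use m in \<open>simp_all add: simps\<close>)
    finally show ?thesis .
  qed
  have coassoc: "tensor_assoc K H H M (tensor_map K H M (H \<boxtimes>\<^bsub>K\<^esub> H) M \<Delta> \<alpha>M (?co m)) =
      tensor_map K H M H (H \<boxtimes>\<^bsub>K\<^esub> M) \<alpha> ?co (?co m)" if m: "m \<in> carrier M" for m
  proof -
    let ?T = "H \<boxtimes>\<^bsub>K\<^esub> (H \<boxtimes>\<^bsub>K\<^esub> M)"
    let ?p = "\<lambda>a b n. pure_tensor K H (H \<boxtimes>\<^bsub>K\<^esub> M) a (pure_tensor K H M b n)"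
    have "tensor_assoc K H H M (tensor_map K H M (H \<boxtimes>\<^bsub>K\<^esub> H) M \<Delta> \<alpha>M (?co m)) =
        tensor_lift K H H ?T (\<lambda>R1 R2.
          tensor_lift K H H ?T (\<lambda>a b. ?p (\<alpha> a) (\<alpha> b) (act (\<alpha> R1) (\<alpha>M m))) (\<Delta> R2)) R"
      using m by (simp add: simps comult_twist M.twist_act)
    also have "\<dots> = tensor_lift K H H ?T (\<lambda>R1 R2. tensor_lift K H H ?T (\<lambda>r1 r2.
        ?p (\<alpha> (\<alpha> r2)) (\<alpha> (\<alpha> R2)) (act (\<mu> R1 r1) (\<alpha>M m))) R) R"
      by (rule tensor_lift_twist_comult_R[where F = "\<lambda>x a b. ?p (\<alpha> a) (\<alpha> b) (act x (\<alpha>M m))"])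
        (use m in \<open>simp_all add: simps\<close>)
    \<comment> \<open>By Hom-associativity \<open>\<mu> R1 r1\<close> acts as \<open>r1\<close>
      followed by \<open>\<alpha> R1\<close>. The sum over \<open>r1\<close>, \<open>r2\<close> thus
      belongs to the first coaction and has to come outside.\<close>
    also have "\<dots> = tensor_lift K H H ?T (\<lambda>r1 r2. tensor_lift K H H ?T (\<lambda>R1 R2.
        ?p (\<alpha> (\<alpha> r2)) (\<alpha> (\<alpha> R2)) (act (\<alpha> R1) (act r1 m))) R) R"
      using m by (subst tensor_lift_swap) (simp_all add: simps M.act_assoc)
    also have "\<dots> = tensor_lift K H H ?T (\<lambda>r1 r2. tensor_lift K H H ?T (\<lambda>R1 R2.
        ?p (\<alpha> (\<alpha> r2)) (\<alpha> R2) (act R1 (act r1 m))) R) R"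
      \<comment> \<open>The underscores in \<open>F\<close> are left to unification; they become the
        outer variables bound by the congruence step.\<close>
      by (intro tensor_lift_cong refl
          tensor_lift_twist_R[where F = "\<lambda>R1 R2. ?p (\<alpha> (\<alpha> _)) (\<alpha> R2) (act R1 (act _ m))"])
        (use m in \<open>simp_all add: simps\<close>)
    also have "\<dots> = tensor_map K H M H (H \<boxtimes>\<^bsub>K\<^esub> M) \<alpha> ?co (?co m)"
      using m by (simp add: simps)
    finally show ?thesis .
  qed
  have compat: "tensor_lift K H H (H \<boxtimes>\<^bsub>K\<^esub> M) (\<lambda>h1 h2.
      tensor_lift K H M (H \<boxtimes>\<^bsub>K\<^esub> M) (\<lambda>x n.
        pure_tensor K H M (\<mu> x (\<alpha> (\<alpha> h2))) n) (?co (act h1 m))) (\<Delta> h) =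
    tensor_lift K H H (H \<boxtimes>\<^bsub>K\<^esub> M) (\<lambda>h1 h2.
      tensor_lift K H M (H \<boxtimes>\<^bsub>K\<^esub> M) (\<lambda>x n.
        pure_tensor K H M (\<mu> (\<alpha> (\<alpha> h1)) (\<alpha> x)) (act (\<alpha> h2) n)) (?co m)) (\<Delta> h)"
    if h: "h \<in> carrier H" and m: "m \<in> carrier M" for h m
  proof -
    let ?T = "H \<boxtimes>\<^bsub>K\<^esub> M"
    \<comment> \<open>Both sides of the condition reduce to the map induced by \<open>?F\<close>:
      the left one at R \<Delta>(h), the right one at the product of the opposite coproduct of h
      with R.\<close>
    let ?F = "\<lambda>x y. pure_tensor K H M (\<alpha> (\<alpha> y)) (act x (\<alpha>M m))"
    have "tensor_lift K H H ?T (\<lambda>h1 h2. tensor_lift K H M ?T (\<lambda>x n.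
          pure_tensor K H M (\<mu> x (\<alpha> (\<alpha> h2))) n) (?co (act h1 m))) (\<Delta> h) =
        tensor_lift K H H ?T (\<lambda>h1 h2. tensor_lift K H H ?T (\<lambda>R1 R2.
          pure_tensor K H M (\<mu> (\<alpha> R2) (\<alpha> (\<alpha> h2))) (act R1 (act h1 m))) R) (\<Delta> h)"
      using h m by (simp add: simps)
    \<comment> \<open>Hom-associativity needs \<open>\<alpha> R1\<close> in front of
      \<open>act h1 m\<close>; twisting the sum over \<open>R\<close> provides it.\<close>
    also have "\<dots> = tensor_lift K H H ?T (\<lambda>h1 h2. tensor_lift K H H ?T (\<lambda>R1 R2.
          pure_tensor K H M (\<mu> (\<alpha> (\<alpha> R2)) (\<alpha> (\<alpha> h2))) (act (\<alpha> R1) (act h1 m))) R) (\<Delta> h)"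
      by (intro tensor_lift_cong refl tensor_lift_twist_R[symmetric,
            where F = "\<lambda>R1 R2. pure_tensor K H M (\<mu> (\<alpha> R2) (\<alpha> (\<alpha> _))) (act R1 (act _ m))"])
        (use h m in \<open>simp_all add: simps\<close>)
    also have "\<dots> = tensor_lift K H H ?T (\<lambda>h1 h2. tensor_lift K H H ?T (\<lambda>R1 R2.
          ?F (\<mu> R1 h1) (\<mu> R2 h2)) R) (\<Delta> h)"
      using h m by (simp add: multilinear twist_mult M.act_assoc)
    also have "\<dots> = tensor_lift K H H ?T (\<lambda>R1 R2. tensor_lift K H H ?T (\<lambda>h1 h2.
          ?F (\<mu> R1 h1) (\<mu> R2 h2)) (\<Delta> h)) R"
      using h m by (subst tensor_lift_swap) (simp_all add: simps)
    also have "\<dots> = tensor_lift K H H ?T (\<lambda>h1 h2. tensor_lift K H H ?T (\<lambda>R1 R2.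
          ?F (\<mu> h2 R1) (\<mu> h1 R2)) R) (\<Delta> h)"
      by (rule tensor_lift_comult_cop_R[symmetric]) (use h m in \<open>simp_all add: simps\<close>)
    \<comment> \<open>On this side the \<open>\<alpha> h2\<close> of the condition already fits
      Hom-associativity, and \<open>R\<close> stays untwisted.\<close>
    also have "\<dots> = tensor_lift K H H ?T (\<lambda>h1 h2. tensor_lift K H M ?T (\<lambda>x n.
        pure_tensor K H M (\<mu> (\<alpha> (\<alpha> h1)) (\<alpha> x)) (act (\<alpha> h2) n)) (?co m)) (\<Delta> h)"
      using h m by (simp add: simps twist_mult M.act_assoc)
    finally show ?thesis .
  qed
  show ?thesis
    by (intro yetter_drinfeld_module.intro hom_comodule.intro hom_comodule_axioms.intro
        yetter_drinfeld_module_axioms.intro assms hom_bialgebra_axioms M.module_space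
        M.module_twist_linear linear twist coassoc compat)
qed

end

section \<open>Tensor products of modules\<close>

text \<open>Makes the inverse of \<open>\<alpha>\<close> in \<open>hat_tensor_coaction\<close>
  accessible to the linearity rules.\<close>

lemma linear_maps_inv_into:
  assumes "module K V" and f: "f \<in> linear_maps K V W" and bij: "bij_betw f (carrier V) (carrier W)"
  shows "inv_into (carrier V) f \<in> linear_maps K W V"
proof -
  interpret V: module K V by fact
  let ?g = "inv_into (carrier V) f"
  note g = bij_betw_inv_into_left[OF bij] bij_betw_inv_into_right[OF bij]
  have gV: "?g y \<in> carrier V" if "y \<in> carrier W" for y
    using bij_betw_inv_into[OF bij] that by (auto simp: bij_betw_def)
  show ?thesis
  proof (rule linear_mapsI)
    fix x y assume "x \<in> carrier W" "y \<in> carrier W"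
    then show "?g (x \<oplus>\<^bsub>W\<^esub> y) = ?g x \<oplus>\<^bsub>V\<^esub> ?g y"
      using g(1)[of "?g x \<oplus>\<^bsub>V\<^esub> ?g y"] by (simp add: linear_mapsD(2)[OF f] gV g(2))
  next
    fix c x assume "c \<in> carrier K" "x \<in> carrier W"
    then show "?g (c \<odot>\<^bsub>W\<^esub> x) = c \<odot>\<^bsub>V\<^esub> ?g x"
      using g(1)[of "c \<odot>\<^bsub>V\<^esub> ?g x"] by (simp add: linear_mapsD(3)[OF f] gV g(2))
  qed (rule gV)
qed

text \<open>The axioms are inherited factor by factor because \<open>\<Delta>\<close> commutes with
  \<open>\<alpha>\<close> and is multiplicative.\<close>

lemma (in hom_bialgebra) tensor_hom_module:
  assumes "hom_module K H \<mu> \<Delta> \<alpha> M \<alpha>M actM" "hom_module K H \<mu> \<Delta> \<alpha> N \<alpha>N actN"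
  shows "hom_module K H \<mu> \<Delta> \<alpha> (M \<boxtimes>\<^bsub>K\<^esub> N) (tensor_map K M N M N \<alpha>M \<alpha>N)
    (tensor_action K H \<Delta> M actM N actN)"
proof -
  interpret M: hom_module K H \<mu> \<Delta> \<alpha> M \<alpha>M actM by fact
  interpret N: hom_module K H \<mu> \<Delta> \<alpha> N \<alpha>N actN by fact
  note simps = tensor_map_def tensor_action_def tensor_lift_simps multilinear
  show ?thesis
  proof (intro hom_module.intro hom_module_axioms.intro hom_bialgebra_axioms)
    show "module K (M \<boxtimes>\<^bsub>K\<^esub> N)" by (simp add: multilinear)
    show "tensor_map K M N M N \<alpha>M \<alpha>N \<in> linear_maps K (M \<boxtimes>\<^bsub>K\<^esub> N) (M \<boxtimes>\<^bsub>K\<^esub> N)"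
      unfolding tensor_map_def by (intro tensor_lift_linear) (simp_all add: multilinear)
    show "tensor_action K H \<Delta> M actM N actN \<in> bilinear_maps K H (M \<boxtimes>\<^bsub>K\<^esub> N) (M \<boxtimes>\<^bsub>K\<^esub> N)"
      unfolding tensor_action_def tensor_map_def by (simp add: multilinear)
  next
    fix h x assume "h \<in> carrier H" "x \<in> carrier (M \<boxtimes>\<^bsub>K\<^esub> N)"
    then show "tensor_map K M N M N \<alpha>M \<alpha>N (tensor_action K H \<Delta> M actM N actN h x) =
      tensor_action K H \<Delta> M actM N actN (\<alpha> h) (tensor_map K M N M N \<alpha>M \<alpha>N x)"
      by (simp add: simps comult_twist M.twist_act N.twist_act)
  next
    fix h h' x assume "h \<in> carrier H" "h' \<in> carrier H" "x \<in> carrier (M \<boxtimes>\<^bsub>K\<^esub> N)"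
    \<comment> \<open>Both sides flatten to a sum over \<open>\<Delta> h\<close>, then
      \<open>\<Delta> h'\<close>, then \<open>x\<close>, so the orders of summation already
      agree.\<close>
    then show "tensor_action K H \<Delta> M actM N actN (\<alpha> h) (tensor_action K H \<Delta> M actM N actN h' x) =
      tensor_action K H \<Delta> M actM N actN (\<mu> h h') (tensor_map K M N M N \<alpha>M \<alpha>N x)"
      by (simp add: simps comult_twist comult_mult tensor_mult_def M.act_assoc N.act_assoc)
  qed
qed

text \<open>On a pure tensor the axiom for (\<Delta> \<otimes> \<alpha>)(R) yields
  \<open>\<mu> R2 r2\<close> in the first leg, with \<open>\<alpha> R1\<close> and
  \<open>\<alpha> r1\<close> acting. Twisting both copies of \<open>R\<close> brings the other
  coaction to the same form, its inverse square of \<open>\<alpha>\<close> cancelling against two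
  applications of \<open>\<alpha>\<close>.\<close>

lemma (in twist_invariant_quasitriangular) R_coaction_tensor:
  assumes "hom_module K H \<mu> \<Delta> \<alpha> M \<alpha>M actM" "hom_module K H \<mu> \<Delta> \<alpha> N \<alpha>N actN"
    and bij: "bij_betw \<alpha> (carrier H) (carrier H)"
    and x: "x \<in> carrier (M \<boxtimes>\<^bsub>K\<^esub> N)"
  shows "R_coaction K H \<alpha> R (M \<boxtimes>\<^bsub>K\<^esub> N) (tensor_action K H \<Delta> M actM N actN) x =
    hat_tensor_coaction K H \<mu> \<alpha> M (R_coaction K H \<alpha> R M actM) N (R_coaction K H \<alpha> R N actN) x"
proof -
  interpret M: hom_module K H \<mu> \<Delta> \<alpha> M \<alpha>M actM by fact
  interpret N: hom_module K H \<mu> \<Delta> \<alpha> N \<alpha>N actN by fact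
  let ?g = "inv_into (carrier H) \<alpha>" and ?T = "H \<boxtimes>\<^bsub>K\<^esub> (M \<boxtimes>\<^bsub>K\<^esub> N)"
  let ?p = "\<lambda>a m n. pure_tensor K H (M \<boxtimes>\<^bsub>K\<^esub> N) a (pure_tensor K M N m n)"
  note g = linear_maps_inv_into[OF H_space twist_linear bij]
  note simps = R_coaction_def hat_tensor_coaction_def tensor_map_def tensor_action_def
    tensor_lift_simps multilinear linear_maps_compose[OF g] linear_mapsD(1)[OF g]
  show ?thesis
  proof (rule linear_maps_tensor_eqI[OF M.module_space N.module_space])
    show "module K ?T" by (simp add: multilinear)
    show "R_coaction K H \<alpha> R (M \<boxtimes>\<^bsub>K\<^esub> N) (tensor_action K H \<Delta> M actM N actN)
        \<in> linear_maps K (M \<boxtimes>\<^bsub>K\<^esub> N) ?T"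
      unfolding R_coaction_def tensor_action_def tensor_map_def by (simp add: simps)
    show "hat_tensor_coaction K H \<mu> \<alpha> M (R_coaction K H \<alpha> R M actM) N (R_coaction K H \<alpha> R N actN)
        \<in> linear_maps K (M \<boxtimes>\<^bsub>K\<^esub> N) ?T"
      unfolding R_coaction_def hat_tensor_coaction_def Let_def
      by (intro tensor_lift_linear) (simp_all add: simps)
  next
    fix m n assume m: "m \<in> carrier M" and n: "n \<in> carrier N"
    have "R_coaction K H \<alpha> R (M \<boxtimes>\<^bsub>K\<^esub> N) (tensor_action K H \<Delta> M actM N actN) (pure_tensor K M N m n) =
      tensor_lift K H H ?T (\<lambda>R1 R2. tensor_lift K H H ?T (\<lambda>a b.
        ?p (\<alpha> R2) (actM a m) (actN b n)) (\<Delta> R1)) R"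
      using m n by (simp add: simps)
    also have "\<dots> = tensor_lift K H H ?T (\<lambda>R1 R2. tensor_lift K H H ?T (\<lambda>r1 r2.
        ?p (\<mu> R2 r2) (actM (\<alpha> R1) m) (actN (\<alpha> r1) n)) R) R"
      by (rule tensor_lift_comult_twist_R[where F = "\<lambda>a b c. ?p c (actM a m) (actN b n)"])
        (use m n in \<open>simp_all add: simps\<close>)
    \<comment> \<open>The square of \<open>\<alpha>\<close> and its inverse are inserted, so that
      the two sums can be untwisted one after the other.\<close>
    also have "\<dots> = tensor_lift K H H ?T (\<lambda>R1 R2. tensor_lift K H H ?T (\<lambda>r1 r2.
        ?p (?g (?g (\<mu> (\<alpha> (\<alpha> R2)) (\<alpha> (\<alpha> r2))))) (actM (\<alpha> R1) m) (actN (\<alpha> r1) n)) R) R"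
      by (simp add: multilinear twist_mult[symmetric] bij_betw_inv_into_left[OF bij])
    also have "\<dots> = tensor_lift K H H ?T (\<lambda>R1 R2. tensor_lift K H H ?T (\<lambda>r1 r2.
        ?p (?g (?g (\<mu> (\<alpha> (\<alpha> R2)) (\<alpha> r2)))) (actM (\<alpha> R1) m) (actN r1 n)) R) R"
      by (intro tensor_lift_cong refl tensor_lift_twist_R[where
            F = "\<lambda>r1 r2. ?p (?g (?g (\<mu> (\<alpha> (\<alpha> _)) (\<alpha> r2)))) (actM (\<alpha> _) m) (actN r1 n)"])
        (use m n in \<open>simp_all add: simps\<close>)
    \<comment> \<open>For the outer sum \<open>F\<close> is itself a sum over \<open>R\<close>,
      bilinear by \<open>tensor_lift_linear_param\<close>.\<close>
    also have "\<dots> = tensor_lift K H H ?T (\<lambda>R1 R2. tensor_lift K H H ?T (\<lambda>r1 r2.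
        ?p (?g (?g (\<mu> (\<alpha> R2) (\<alpha> r2)))) (actM R1 m) (actN r1 n)) R) R"
      by (rule tensor_lift_twist_R[where F = "\<lambda>R1 R2. tensor_lift K H H ?T (\<lambda>r1 r2.
            ?p (?g (?g (\<mu> (\<alpha> R2) (\<alpha> r2)))) (actM R1 m) (actN r1 n)) R"])
        (use m n in \<open>simp_all add: simps\<close>)
    also have "\<dots> = hat_tensor_coaction K H \<mu> \<alpha> M (R_coaction K H \<alpha> R M actM) N
        (R_coaction K H \<alpha> R N actN) (pure_tensor K M N m n)"
      using m n by (simp add: simps Let_def)
    finally show "R_coaction K H \<alpha> R (M \<boxtimes>\<^bsub>K\<^esub> N) (tensor_action K H \<Delta> M actM N actN)
        (pure_tensor K M N m n) = \<dots>" .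
  qed (rule x)
qed

text \<open>The two coactions on the tensor product are compared on its carrier only, so one cannot
  simply be substituted for the other as a function.\<close>

lemma yetter_drinfeld_module_cong:
  assumes "yetter_drinfeld_module K H \<mu> \<Delta> \<alpha> M \<alpha>M act coact"
    and eq: "\<And>m. m \<in> carrier M \<Longrightarrow> coact m = coact' m"
  shows "yetter_drinfeld_module K H \<mu> \<Delta> \<alpha> M \<alpha>M act coact'"
proof -
  interpret yetter_drinfeld_module K H \<mu> \<Delta> \<alpha> M \<alpha>M act coact by fact
  interpret M: module K M by (rule module_space)
  have linear: "coact' \<in> linear_maps K M (H \<boxtimes>\<^bsub>K\<^esub> M)"
    using linear_mapsD[OF coact_linear] linear_mapsD[OF module_twist_linear]
    by (intro linear_mapsI) (simp_all add: eq[symmetric])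
  show ?thesis
  proof (intro yetter_drinfeld_module.intro hom_comodule.intro hom_comodule_axioms.intro
      yetter_drinfeld_module_axioms.intro hom_module_axioms hom_bialgebra_axioms module_space
      module_twist_linear linear)
    fix m assume m: "m \<in> carrier M"
    show "tensor_map K H M H M \<alpha> \<alpha>M (coact' m) = coact' (\<alpha>M m)"
      using twist_coact[OF m] m by (simp add: eq multilinear)
    show "tensor_assoc K H H M (tensor_map K H M (H \<boxtimes>\<^bsub>K\<^esub> H) M \<Delta> \<alpha>M (coact' m)) =
        tensor_map K H M H (H \<boxtimes>\<^bsub>K\<^esub> M) \<alpha> coact' (coact' m)"
      \<comment> \<open>\<open>coact'\<close> enters \<open>tensor_map\<close> as an unapplied
        function; unfolding exposes its argument, which the congruence rule places in the
        carrier.\<close>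
      using coact_coassoc[OF m] m by (simp add: eq tensor_map_def)
  next
    fix h m assume h: "h \<in> carrier H" and m: "m \<in> carrier M"
    show "tensor_lift K H H (H \<boxtimes>\<^bsub>K\<^esub> M) (\<lambda>h1 h2. tensor_lift K H M (H \<boxtimes>\<^bsub>K\<^esub> M) (\<lambda>x n.
          pure_tensor K H M (\<mu> x (\<alpha> (\<alpha> h2))) n) (coact' (act h1 m))) (\<Delta> h) =
        tensor_lift K H H (H \<boxtimes>\<^bsub>K\<^esub> M) (\<lambda>h1 h2. tensor_lift K H M (H \<boxtimes>\<^bsub>K\<^esub> M) (\<lambda>x n.
          pure_tensor K H M (\<mu> (\<alpha> (\<alpha> h1)) (\<alpha> x)) (act (\<alpha> h2) n)) (coact' m)) (\<Delta> h)"
      using yetter_drinfeld[OF h m] m by (simp add: eq multilinear)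
  qed
qed

theorem proposition3p8:
  fixes K :: "('k, 'p) ring_scheme"
    and H :: "('k, 'h, 'q) module_scheme"
    and \<mu> :: "'h \<Rightarrow> 'h \<Rightarrow> 'h"
    and \<Delta> :: "'h \<Rightarrow> ('h \<times> 'h \<Rightarrow> 'k) set"
    and \<alpha> :: "'h \<Rightarrow> 'h"
    and R :: "('h \<times> 'h \<Rightarrow> 'k) set"
    and M :: "('k, 'm, 'r) module_scheme"
    and \<alpha>M :: "'m \<Rightarrow> 'm"
    and actM :: "'h \<Rightarrow> 'm \<Rightarrow> 'm"
    and N :: "('k, 'n, 's) module_scheme"
    and \<alpha>N :: "'n \<Rightarrow> 'n"
    and actN :: "'h \<Rightarrow> 'n \<Rightarrow> 'n"
  assumes "quasitriangular_hom_bialgebra K H \<mu> \<Delta> \<alpha> R"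
    and "tensor_map K H H H H \<alpha> \<alpha> R = R"
    and "hom_module K H \<mu> \<Delta> \<alpha> M \<alpha>M actM"
  shows "yetter_drinfeld_module K H \<mu> \<Delta> \<alpha> M \<alpha>M actM (R_coaction K H \<alpha> R M actM) \<and>
    (bij_betw \<alpha> (carrier H) (carrier H) \<and> hom_module K H \<mu> \<Delta> \<alpha> N \<alpha>N actN \<longrightarrow>
      (let MN = M \<boxtimes>\<^bsub>K\<^esub> N;
           \<alpha>MN = tensor_map K M N M N \<alpha>M \<alpha>N;
           actMN = tensor_action K H \<Delta> M actM N actN;
           coactMN = R_coaction K H \<alpha> R MN actMN;
           coact_hat = hat_tensor_coaction K H \<mu> \<alpha>
             M (R_coaction K H \<alpha> R M actM) N (R_coaction K H \<alpha> R N actN)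
       in hom_module K H \<mu> \<Delta> \<alpha> MN \<alpha>MN actMN \<and>
          yetter_drinfeld_module K H \<mu> \<Delta> \<alpha> MN \<alpha>MN actMN coactMN \<and>
          yetter_drinfeld_module K H \<mu> \<Delta> \<alpha> MN \<alpha>MN actMN coact_hat \<and>
          (\<forall>x\<in>carrier MN. coactMN x = coact_hat x)))"
proof -
  interpret twist_invariant_quasitriangular K H \<mu> \<Delta> \<alpha> R
    using assms(1,2)
    by (simp add: twist_invariant_quasitriangular_def twist_invariant_quasitriangular_axioms_def)
  show ?thesis
    unfolding Let_def
    \<comment> \<open>The Yetter-Drinfeld property of the hat coaction is carried over from the
      coaction given by \<open>R\<close> on the tensor product.\<close>
    by (intro conjI impI ballI R_coaction_yetter_drinfeld tensor_hom_module R_coaction_tensor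
        yetter_drinfeld_module_cong[OF R_coaction_yetter_drinfeld R_coaction_tensor])
      (use assms(3) in blast)+
qed

end
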